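(* Let $\theta\in(0,\pi/2)$ be fixed. There exists a sequence of positive integers $n = n(d)$ with $$n(d) \ge (1+o(1)) \frac{c_\theta \cdot d}{s_d(\theta)}$$ such that $$\frac{1}{n} \log\left( \frac{\mathbb{P}[E_{d,\theta,n}]}{n!} \right) \ge \log s_d(q(\theta)) + o(1),$$ where both $o(1)$ terms are as $d\to\infty$.
   Context: $S_{d-1}$ is the unit sphere in $\mathbb{R}^d$. A spherical code of angle $\theta$ in dimension $d$ is a set of unit vectors $x_1,\dots,x_k \in S_{d-1}$ with $\langle x_i,x_j\rangle \le \cos\theta$ for all $i\neq j$. $E_{d,\theta,n}$ is the event that $n$ points chosen independently and uniformly at random from $S_{d-1}$ form a spherical code of angle $\theta$. $s_d(\theta)$ is the normalized surface area (total area of $S_{d-1}$ equal to $1$) of a spherical cap $\{y \in S_{d-1}: \langle x,y\rangle\ge\cos\theta\}$ of angular radius $\theta$, i.e. $$s_d(\theta) = \frac{1}{\sqrt{\pi}} \frac{\Gamma(d/2)}{\Gamma((d-1)/2)} \int_0^\theta \sin^{d-2} x \, dx.$$ $q(\theta)$ is the angular radius of the smallest spherical cap that contains the intersection of two spherical caps of angular radius $\theta$ whose centers are at angle $\theta$; that is, $$q(\theta) = \arcsin\left(\frac{\sqrt{(\cos\theta-1)^2(1+2\cos\theta)}}{\sin\theta}\right),$$ and $$c_\theta = \log\left(\frac{\sin\theta}{\sin q(\theta)}\right) = \log \frac{\sin^2\theta}{\sqrt{(1-\cos\theta)^2(1+2\cos\theta)}}.$$ $\log$ is the natural logarithm. 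*)

theory Defs
  imports "HOL-Probability.Probability"
begin

text \<open>
  Since the dimension \<open>d\<close> tends to infinity, it cannot be a type: \<open>\<real>\<^sup>d\<close> is rendered as the space of
  \<open>\<^term>\<open>Pi\<^sub>M {..<d} (\<lambda>_. lborel :: real measure)\<close>\<close>, that is, real functions on \<open>{..<d}\<close> (undefined
  outside \<open>{..<d}\<close>) with Lebesgue measure.
\<close>

abbreviation Rd :: "nat \<Rightarrow> (nat \<Rightarrow> real) measure" where
  "Rd d \<equiv> Pi\<^sub>M {..<d} (\<lambda>_. lborel)"

definition inner_d :: "nat \<Rightarrow> (nat \<Rightarrow> real) \<Rightarrow> (nat \<Rightarrow> real) \<Rightarrow> real" where
  "inner_d d x y = (\<Sum>i<d. x i * y i)"

definition norm_d :: "nat \<Rightarrow> (nat \<Rightarrow> real) \<Rightarrow> real" where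
  "norm_d d x = sqrt (inner_d d x x)"

definition unit_sphere :: "nat \<Rightarrow> (nat \<Rightarrow> real) set" where
  "unit_sphere d = {x \<in> space (Rd d). norm_d d x = 1}"

definition unit_ball :: "nat \<Rightarrow> (nat \<Rightarrow> real) set" where
  "unit_ball d = {x \<in> space (Rd d). norm_d d x \<le> 1}"

text \<open>
  Normalized surface measure on the sphere, as the law of \<open>x / \<parallel>x\<parallel>\<close> for a uniformly distributed
  point \<open>x\<close> of the unit ball: a set has normalized area equal to the proportion of the volume of the
  ball taken up by the cone over it. The origin, where \<open>x / \<parallel>x\<parallel>\<close> is not on the sphere, is a null set
  for \<open>d \<ge> 1\<close>, so restricting to the sphere leaves a probability measure.
\<close>

definition sphere_measure :: "nat \<Rightarrow> (nat \<Rightarrow> real) measure" where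
  "sphere_measure d =
     restrict_space
       (distr (uniform_measure (Rd d) (unit_ball d)) (Rd d) (\<lambda>x. \<lambda>i\<in>{..<d}. x i / norm_d d x))
       (unit_sphere d)"

definition spherical_code :: "nat \<Rightarrow> real \<Rightarrow> nat \<Rightarrow> (nat \<Rightarrow> nat \<Rightarrow> real) \<Rightarrow> bool" where
  "spherical_code d \<theta> k x \<longleftrightarrow>
     (\<forall>i<k. x i \<in> unit_sphere d) \<and>
     (\<forall>i<k. \<forall>j<k. i \<noteq> j \<longrightarrow> inner_d d (x i) (x j) \<le> cos \<theta>)"

definition random_points :: "nat \<Rightarrow> nat \<Rightarrow> (nat \<Rightarrow> nat \<Rightarrow> real) measure" where
  "random_points d n = Pi\<^sub>M {..<n} (\<lambda>_. sphere_measure d)"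

definition code_event :: "nat \<Rightarrow> real \<Rightarrow> nat \<Rightarrow> (nat \<Rightarrow> nat \<Rightarrow> real) set" where
  "code_event d \<theta> n = {x \<in> space (random_points d n). spherical_code d \<theta> n x}"

definition code_prob :: "nat \<Rightarrow> real \<Rightarrow> nat \<Rightarrow> real" where
  "code_prob d \<theta> n = measure (random_points d n) (code_event d \<theta> n)"

definition spherical_cap :: "nat \<Rightarrow> (nat \<Rightarrow> real) \<Rightarrow> real \<Rightarrow> (nat \<Rightarrow> real) set" where
  "spherical_cap d x \<theta> = {y \<in> unit_sphere d. inner_d d x y \<ge> cos \<theta>}"

definition pole :: "nat \<Rightarrow> nat \<Rightarrow> real" where
  "pole d = (\<lambda>i\<in>{..<d}. if i = 0 then 1 else 0)"

text \<open>The area of a cap does not depend on its centre; we take the centre \<open>(1, 0, \<dots>, 0)\<close>.\<close>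

definition cap_area :: "nat \<Rightarrow> real \<Rightarrow> real" where
  "cap_area d \<theta> = measure (sphere_measure d) (spherical_cap d (pole d) \<theta>)"

text \<open>
  \<open>cap_q \<theta>\<close> is the angular radius of the smallest cap containing the intersection of two caps of
  angular radius \<open>\<theta>\<close> whose centres are at angle \<open>\<theta>\<close>.
\<close>

definition cap_q :: "real \<Rightarrow> real" where
  "cap_q \<theta> = arcsin (sqrt ((cos \<theta> - 1)\<^sup>2 * (1 + 2 * cos \<theta>)) / sin \<theta>)"

definition cap_c :: "real \<Rightarrow> real" where
  "cap_c \<theta> = ln (sin \<theta> / sin (cap_q \<theta>))"

lemma norm_d_eq: "norm_d d x = sqrt (\<Sum>i<d. (x i)\<^sup>2)"
  by (simp add: norm_d_def inner_d_def power2_eq_square)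

lemma inner_d_measurable [measurable]:
  assumes "f \<in> measurable M (Rd d)" "g \<in> measurable M (Rd d)"
  shows "(\<lambda>x. inner_d d (f x) (g x)) \<in> borel_measurable M"
proof -
  have "(\<lambda>x. f x i) \<in> borel_measurable M" "(\<lambda>x. g x i) \<in> borel_measurable M" if "i < d" for i
    using measurable_compose[OF assms(1), of "\<lambda>x. x i" borel]
      measurable_compose[OF assms(2), of "\<lambda>x. x i" borel] that
      measurable_component_singleton[of i "{..<d}" "\<lambda>_. lborel :: real measure"]
    by auto
  thus ?thesis unfolding inner_d_def by (intro borel_measurable_sum borel_measurable_times) auto
qed

lemma norm_d_measurable [measurable]: "norm_d d \<in> borel_measurable (Rd d)"
  unfolding norm_d_def by measurable

lemma unit_sphere_sets [measurable]: "unit_sphere d \<in> sets (Rd d)"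
  unfolding unit_sphere_def by measurable

lemma unit_ball_sets [measurable]: "unit_ball d \<in> sets (Rd d)"
  unfolding unit_ball_def by measurable

lemma normalise_measurable [measurable]:
  "(\<lambda>x. \<lambda>i\<in>{..<d}. x i / norm_d d x) \<in> measurable (Rd d) (Rd d)"
proof (rule measurable_restrict)
  fix i assume i: "i \<in> {..<d}"
  have "(\<lambda>x. x i) \<in> borel_measurable (Rd d)"
    using measurable_component_singleton[OF i, of "\<lambda>_. lborel :: real measure"] by simp
  thus "(\<lambda>x. x i / norm_d d x) \<in> measurable (Rd d) lborel"
    by (simp add: borel_measurable_divide norm_d_measurable)
qed

lemma emeasure_unit_ball: "emeasure (Rd d) (unit_ball d) = ennreal (unit_ball_vol (real d))"
  using emeasure_cball_aux[of "{..<d}" 1]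
  by (simp add: unit_ball_def norm_d_eq Int_def conj_commute)

lemma space_sphere_measure [simp]: "space (sphere_measure d) = unit_sphere d"
  by (auto simp: sphere_measure_def space_restrict_space unit_sphere_def)

lemma sets_sphere_measure: "sets (sphere_measure d) = sets (restrict_space (Rd d) (unit_sphere d))"
  unfolding sphere_measure_def by (intro sets_restrict_space_cong) simp

lemma normalise_in_sphere:
  assumes "x \<in> space (Rd d)" "norm_d d x \<noteq> 0"
  shows "(\<lambda>i\<in>{..<d}. x i / norm_d d x) \<in> unit_sphere d"
proof -
  have "(norm_d d x)\<^sup>2 = (\<Sum>i<d. (x i)\<^sup>2)" by (simp add: norm_d_eq sum_nonneg)
  moreover have "norm_d d (\<lambda>i\<in>{..<d}. x i / norm_d d x) = sqrt ((\<Sum>i<d. (x i)\<^sup>2) / (norm_d d x)\<^sup>2)"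
    by (simp add: norm_d_eq[of d "restrict _ _"] power_divide flip: sum_divide_distrib)
  ultimately have "norm_d d (\<lambda>i\<in>{..<d}. x i / norm_d d x) = 1"
    using assms(2) by (metis div_self power_eq_0_iff real_sqrt_one)
  thus ?thesis by (auto simp: unit_sphere_def space_PiM)
qed

lemma emeasure_sphere_measure:
  assumes "A \<subseteq> unit_sphere d" "A \<in> sets (Rd d)"
  shows "emeasure (sphere_measure d) A =
     emeasure (Rd d) {x \<in> unit_ball d. (\<lambda>i\<in>{..<d}. x i / norm_d d x) \<in> A} / unit_ball_vol d"
proof -
  let ?f = "\<lambda>x. \<lambda>i\<in>{..<d}. x i / norm_d d x"
  have f: "?f \<in> measurable (uniform_measure (Rd d) (unit_ball d)) (Rd d)"
    using normalise_measurable by (simp cong: measurable_cong_sets)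
  have pre: "?f -` A \<inter> space (Rd d) \<in> sets (Rd d)"
    using normalise_measurable assms(2) by (rule measurable_sets)
  have "emeasure (sphere_measure d) A =
      emeasure (distr (uniform_measure (Rd d) (unit_ball d)) (Rd d) ?f) A"
    unfolding sphere_measure_def using assms by (intro emeasure_restrict_space) auto
  also have "\<dots> = emeasure (uniform_measure (Rd d) (unit_ball d)) (?f -` A \<inter> space (Rd d))"
    using assms f by (subst emeasure_distr) auto
  also have "\<dots> = emeasure (Rd d) (unit_ball d \<inter> (?f -` A \<inter> space (Rd d))) / unit_ball_vol d"
    using pre by (subst emeasure_uniform_measure) (auto simp: emeasure_unit_ball)
  also have "unit_ball d \<inter> (?f -` A \<inter> space (Rd d)) = {x \<in> unit_ball d. ?f x \<in> A}"
    by (auto simp: unit_ball_def)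
  finally show ?thesis .
qed

lemma emeasure_origin:
  assumes "d \<ge> 1"
  shows "emeasure (Rd d) {x \<in> space (Rd d). norm_d d x = 0} = 0"
proof -
  interpret product_sigma_finite "\<lambda>_. lborel :: real measure" by standard
  have "{x \<in> space (Rd d). norm_d d x = 0} = (\<Pi>\<^sub>E i\<in>{..<d}. {0})"
    by (auto simp: norm_d_eq space_PiM sum_nonneg_eq_0_iff PiE_iff extensional_def)
  moreover have "emeasure (Rd d) (\<Pi>\<^sub>E i\<in>{..<d}. {0}) = 0"
    using assms by (subst emeasure_PiM) (auto simp: power_0_left)
  ultimately show ?thesis by simp
qed

lemma prob_space_sphere_measure:
  assumes "d \<ge> 1"
  shows "prob_space (sphere_measure d)"
proof
  let ?f = "\<lambda>x. \<lambda>i\<in>{..<d}. x i / norm_d d x"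
  let ?O = "{x \<in> space (Rd d). norm_d d x = 0}"
  have O: "?O \<in> null_sets (Rd d)" using emeasure_origin[OF assms] by (intro null_setsI) auto
  have "{x \<in> unit_ball d. ?f x \<in> unit_sphere d} = unit_ball d - ?O"
    using normalise_in_sphere
    by (auto simp: unit_ball_def) (auto simp: unit_sphere_def norm_d_eq[of d "restrict _ _"])
  hence "emeasure (Rd d) {x \<in> unit_ball d. ?f x \<in> unit_sphere d} = unit_ball_vol d"
    using emeasure_Diff_null_set[OF O, of "unit_ball d"] by (simp add: emeasure_unit_ball)
  moreover have "unit_ball_vol (real d) \<noteq> 0" using unit_ball_vol_pos[of "real d"] by linarith
  ultimately show "emeasure (sphere_measure d) (space (sphere_measure d)) = 1"
    using emeasure_sphere_measure[of "unit_sphere d" d]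
    by (simp add: divide_ennreal flip: ennreal_1)
qed

lemma prob_space_random_points:
  assumes "d \<ge> 1"
  shows "prob_space (random_points d n)"
  unfolding random_points_def using prob_space_sphere_measure[OF assms] by (intro prob_space_PiM)

lemma spherical_cap_sets: "x \<in> space (Rd d) \<Longrightarrow> spherical_cap d x \<theta> \<in> sets (Rd d)"
  unfolding spherical_cap_def by measurable

lemma code_event_sets: "code_event d \<theta> n \<in> sets (random_points d n)"
proof -
  have id: "(\<lambda>x. x) \<in> measurable (sphere_measure d) (Rd d)"
    using measurable_restrict_space1[of "\<lambda>x. x" "Rd d" "Rd d" "unit_sphere d"]
    by (simp cong: measurable_cong_sets add: sets_sphere_measure)
  have comp: "(\<lambda>x. x i) \<in> measurable (random_points d n) (Rd d)" if "i < n" for i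
    using measurable_compose[OF measurable_component_singleton[of i "{..<n}"
      "\<lambda>_. sphere_measure d"] id] that
    by (simp add: random_points_def)
  have "{x \<in> space (random_points d n). inner_d d (x i) (x j) \<le> cos \<theta>} \<in> sets (random_points d n)"
    if "i < n" "j < n" for i j
    using inner_d_measurable[OF comp[OF that(1)] comp[OF that(2)]] by measurable
  hence "{x \<in> space (random_points d n). \<forall>i\<in>{..<n}. \<forall>j\<in>{..<n}. i \<noteq> j \<longrightarrow>
      inner_d d (x i) (x j) \<le> cos \<theta>} \<in> sets (random_points d n)"
    by (intro sets.sets_Collect_finite_All' sets.sets_Collect_finite_All sets.sets_Collect_imp) auto
  also have "{x \<in> space (random_points d n). \<forall>i\<in>{..<n}. \<forall>j\<in>{..<n}. i \<noteq> j \<longrightarrow>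
      inner_d d (x i) (x j) \<le> cos \<theta>} = code_event d \<theta> n"
    by (auto simp: code_event_def spherical_code_def random_points_def space_PiM PiE_iff)
  finally show ?thesis .
qed

lemma cap_integral:
  fixes \<theta> :: real and m :: nat
  assumes \<theta>: "0 < \<theta>" "\<theta> < pi / 2" and m: "m \<ge> 1"
  shows "((\<lambda>t. min (t * tan \<theta>) (sqrt (1 - t\<^sup>2)) ^ m) has_integral
           (real m / real (Suc m) * integral {0..\<theta>} (\<lambda>x. sin x ^ (m - 1)))) {0..1}"
proof -
  define I where "I = integral {0..\<theta>} (\<lambda>x. sin x ^ (m - 1))"
  have cs: "cos \<theta> > 0" "sin \<theta> > 0" "cos \<theta> \<le> 1"
    using \<theta> by (auto intro: cos_gt_zero sin_gt_zero)
  have tan: "tan \<theta> > 0" "(tan \<theta>)\<^sup>2 = (1 - (cos \<theta>)\<^sup>2) / (cos \<theta>)\<^sup>2"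
    using cs by (auto simp: tan_def power_divide sin_squared_eq)
  have cmp: "t * tan \<theta> \<le> sqrt (1 - t\<^sup>2) \<longleftrightarrow> t \<le> cos \<theta>" if "0 \<le> t" "t \<le> 1" for t
  proof -
    have "t * tan \<theta> \<le> sqrt (1 - t\<^sup>2) \<longleftrightarrow> (t * tan \<theta>)\<^sup>2 \<le> 1 - t\<^sup>2"
      using that tan(1) by (metis mult_nonneg_nonneg less_imp_le real_sqrt_le_iff real_sqrt_unique)
    also have "\<dots> \<longleftrightarrow> t\<^sup>2 \<le> (cos \<theta>)\<^sup>2"
      using cs by (simp add: power_mult_distrib tan(2) field_simps)
    also have "\<dots> \<longleftrightarrow> t \<le> cos \<theta>" using that cs by (simp add: abs_le_square_iff [symmetric])
    finally show ?thesis .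
  qed
  have 1: "((\<lambda>t. (t * tan \<theta>) ^ m) has_integral (cos \<theta> * sin \<theta> ^ m / real (Suc m))) {0..cos \<theta>}"
  proof -
    have "((\<lambda>t. (t * tan \<theta>) ^ m) has_integral
        (cos \<theta> ^ Suc m * tan \<theta> ^ m / real (Suc m) - 0 ^ Suc m * tan \<theta> ^ m / real (Suc m))) {0..cos \<theta>}"
    proof (intro fundamental_theorem_of_calculus)
      fix t assume "t \<in> {0..cos \<theta>}"
      have "((\<lambda>t. t ^ Suc m * tan \<theta> ^ m / real (Suc m)) has_real_derivative
          real (Suc m) * t ^ m * tan \<theta> ^ m / real (Suc m)) (at t within {0..cos \<theta>})"
        by (auto intro!: derivative_eq_intros simp del: power_Suc of_nat_Suc)
      thus "((\<lambda>t. t ^ Suc m * tan \<theta> ^ m / real (Suc m)) has_vector_derivative (t * tan \<theta>) ^ m)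
          (at t within {0..cos \<theta>})"
        by (simp add: power_mult_distrib del: power_Suc of_nat_Suc
          flip: has_real_derivative_iff_has_vector_derivative)
    qed (use cs in auto)
    also have "cos \<theta> ^ Suc m * tan \<theta> ^ m / real (Suc m) - 0 ^ Suc m * tan \<theta> ^ m / real (Suc m) =
        cos \<theta> * sin \<theta> ^ m / real (Suc m)"
      using cs by (simp add: tan_def power_divide)
    finally show ?thesis .
  qed
  define J where "J = integral {cos \<theta>..1} (\<lambda>t. sqrt (1 - t\<^sup>2) ^ m)"
  have J: "((\<lambda>t. sqrt (1 - t\<^sup>2) ^ m) has_integral J) {cos \<theta>..1}"
    unfolding J_def by (intro integrable_integral integrable_continuous_real continuous_intros)
  have "((\<lambda>x. - sin x *\<^sub>R (sqrt (1 - (cos x)\<^sup>2) ^ m)) has_integral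
      (integral {cos 0..cos \<theta>} (\<lambda>t. sqrt (1 - t\<^sup>2) ^ m) - integral {cos \<theta>..cos 0} (\<lambda>t. sqrt (1 - t\<^sup>2) ^ m)))
      {0..\<theta>}"
    using \<theta> by (intro has_integral_substitution_general[of "{}" 0 \<theta> cos "-1" 1])
      (auto intro!: derivative_eq_intros continuous_intros)
  also have "integral {cos 0..cos \<theta>} (\<lambda>t. sqrt (1 - t\<^sup>2) ^ m) = 0"
  proof (cases "cos \<theta> = 1")
    case False
    hence "\<not> 1 \<le> cos \<theta>" using cs(3) by linarith
    hence "{cos 0..cos \<theta>} = {}" by simp
    thus ?thesis by (simp only: integral_empty)
  qed simp
  finally have "((\<lambda>x. - sin x *\<^sub>R (sqrt (1 - (cos x)\<^sup>2) ^ m)) has_integral - J) {0..\<theta>}"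
    by (simp add: J_def)
  hence "((\<lambda>x. sin x * (sqrt (1 - (cos x)\<^sup>2) ^ m)) has_integral J) {0..\<theta>}"
    by (auto dest: has_integral_neg)
  also have "?this \<longleftrightarrow> ((\<lambda>x. sin x ^ Suc m) has_integral J) {0..\<theta>}"
    using \<theta> by (intro has_integral_cong)
      (auto simp: sin_squared_eq [symmetric] sin_ge_zero)
  finally have 2: "((\<lambda>x. sin x ^ Suc m) has_integral J) {0..\<theta>}" .
  have 3: "((\<lambda>x. sin x ^ (m - 1)) has_integral I) {0..\<theta>}"
    unfolding I_def by (intro integrable_integral integrable_continuous_real continuous_intros)
  have 4: "((\<lambda>x. real (Suc m) * sin x ^ Suc m - real m * sin x ^ (m - 1)) has_integral
          (- cos \<theta> * sin \<theta> ^ m - (- cos 0 * sin 0 ^ m))) {0..\<theta>}"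
  proof (intro fundamental_theorem_of_calculus)
    fix x assume "x \<in> {0..\<theta>}"
    have "((\<lambda>x. - cos x * sin x ^ m) has_real_derivative
      sin x * sin x ^ m - cos x * (real m * sin x ^ (m - 1) * cos x)) (at x within {0..\<theta>})"
      by (auto intro!: derivative_eq_intros)
    also have "cos x * (real m * sin x ^ (m - 1) * cos x) = real m * sin x ^ (m - 1) * (cos x)\<^sup>2"
      by (simp add: power2_eq_square)
    also have "\<dots> = real m * sin x ^ (m - 1) - real m * (sin x ^ (m - 1) * (sin x)\<^sup>2)"
      by (simp add: cos_squared_eq algebra_simps)
    also have "sin x ^ (m - 1) * (sin x)\<^sup>2 = sin x ^ Suc m"
      using m by (simp flip: power_add)
    finally show "((\<lambda>x. - cos x * sin x ^ m) has_vector_derivative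
      real (Suc m) * sin x ^ Suc m - real m * sin x ^ (m - 1)) (at x within {0..\<theta>})"
      by (simp add: algebra_simps flip: has_real_derivative_iff_has_vector_derivative)
  qed (use \<theta> in auto)
  have 5: "((\<lambda>x. real (Suc m) * sin x ^ Suc m - real m * sin x ^ (m - 1)) has_integral
      (real (Suc m) * J - real m * I)) {0..\<theta>}"
    by (intro has_integral_diff has_integral_mult_right 2 3)
  have "real (Suc m) * J - real m * I = - cos \<theta> * sin \<theta> ^ m"
    using has_integral_unique[OF 5 4] m by simp
  hence eq: "cos \<theta> * sin \<theta> ^ m / real (Suc m) + J = real m / real (Suc m) * I"
    by (simp add: field_simps)
  have "((\<lambda>t. min (t * tan \<theta>) (sqrt (1 - t\<^sup>2)) ^ m) has_integral
      (cos \<theta> * sin \<theta> ^ m / real (Suc m))) {0..cos \<theta>}"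
    using 1
  proof (rule has_integral_eq[rotated])
    fix t assume t: "t \<in> {0..cos \<theta>}"
    hence "t * tan \<theta> \<le> sqrt (1 - t\<^sup>2)" using cmp[of t] cs by auto
    thus "(t * tan \<theta>) ^ m = min (t * tan \<theta>) (sqrt (1 - t\<^sup>2)) ^ m" by (simp add: min_def)
  qed
  moreover have "((\<lambda>t. min (t * tan \<theta>) (sqrt (1 - t\<^sup>2)) ^ m) has_integral J) {cos \<theta>..1}"
    using J
  proof (rule has_integral_eq[rotated])
    fix t assume t: "t \<in> {cos \<theta>..1}"
    show "sqrt (1 - t\<^sup>2) ^ m = min (t * tan \<theta>) (sqrt (1 - t\<^sup>2)) ^ m"
    proof (cases "t = cos \<theta>")
      case True
      have "t * tan \<theta> = sqrt (1 - t\<^sup>2)" 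
        using cs by (simp add: True tan_def flip: sin_squared_eq)
      thus ?thesis by simp
    next
      case False
      thus ?thesis using cmp[of t] t cs by auto
    qed
  qed
  ultimately have "((\<lambda>t. min (t * tan \<theta>) (sqrt (1 - t\<^sup>2)) ^ m) has_integral
      (cos \<theta> * sin \<theta> ^ m / real (Suc m) + J)) {0..1}"
    using cs by (intro has_integral_combine[of 0 "cos \<theta>" 1]) auto
  thus ?thesis by (simp only: eq I_def)
qed

lemma cone_volume:
  fixes \<theta> :: real and m :: nat
  assumes \<theta>: "0 < \<theta>" "\<theta> < pi / 2" and m: "m \<ge> 1"
  defines "C \<equiv> {x \<in> unit_ball (Suc m). x 0 > 0 \<and> cos \<theta> * norm_d (Suc m) x \<le> x 0}"
  shows "emeasure (Rd (Suc m)) C = ennreal (unit_ball_vol (real m) *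
           (real m / real (Suc m) * integral {0..\<theta>} (\<lambda>x. sin x ^ (m - 1))))"
proof -
  interpret product_sigma_finite "\<lambda>_. lborel :: real measure" by standard
  let ?A = "{1..m}" and ?r = "\<lambda>t. min (t * tan \<theta>) (sqrt (1 - t\<^sup>2))"
  have I: "{..<Suc m} = insert 0 ?A" by auto
  have cs: "cos \<theta> > 0" "sin \<theta> > 0" using \<theta> by (auto intro: cos_gt_zero sin_gt_zero)
  have tan: "tan \<theta> > 0" "(tan \<theta>)\<^sup>2 = (1 - (cos \<theta>)\<^sup>2) / (cos \<theta>)\<^sup>2"
    using cs by (auto simp: tan_def power_divide sin_squared_eq)
  have m0: "(\<lambda>x. x 0) \<in> borel_measurable (Rd (Suc m))"
    using measurable_component_singleton[of 0 "{..<Suc m}" "\<lambda>_. lborel :: real measure"] by simp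
  have C: "C \<in> sets (Rd (Suc m))"
  proof -
    have "C = unit_ball (Suc m) \<inter> {x \<in> space (Rd (Suc m)). 0 < x 0} \<inter>
        {x \<in> space (Rd (Suc m)). cos \<theta> * norm_d (Suc m) x \<le> x 0}"
      by (auto simp: C_def unit_ball_def)
    also have "\<dots> \<in> sets (Rd (Suc m))"
      by (intro sets.Int unit_ball_sets borel_measurable_less borel_measurable_le
        borel_measurable_times borel_measurable_const norm_d_measurable m0)
    finally show ?thesis .
  qed
  have key: "sqrt (y\<^sup>2 + S) \<le> 1 \<and> y > 0 \<and> cos \<theta> * sqrt (y\<^sup>2 + S) \<le> y \<longleftrightarrow>
      y \<in> {0<..1} \<and> sqrt S \<le> ?r y" if "S \<ge> 0" for y S :: real
  proof (cases "y > 0")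
    case True
    have "cos \<theta> * sqrt (y\<^sup>2 + S) \<le> y \<longleftrightarrow> sqrt (y\<^sup>2 + S) \<le> y / cos \<theta>"
      using cs by (simp add: pos_le_divide_eq mult.commute)
    also have "y / cos \<theta> = sqrt ((y / cos \<theta>)\<^sup>2)"
      using True cs by simp
    also have "sqrt (y\<^sup>2 + S) \<le> sqrt ((y / cos \<theta>)\<^sup>2) \<longleftrightarrow> y\<^sup>2 + S \<le> (y / cos \<theta>)\<^sup>2"
      by (rule real_sqrt_le_iff)
    also have "\<dots> \<longleftrightarrow> S \<le> (y * tan \<theta>)\<^sup>2"
      using cs by (simp add: power_mult_distrib tan(2) field_simps)
    also have "\<dots> \<longleftrightarrow> sqrt S \<le> sqrt ((y * tan \<theta>)\<^sup>2)" by (simp only: real_sqrt_le_iff)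
    also have "\<dots> \<longleftrightarrow> sqrt S \<le> y * tan \<theta>" using True tan by simp
    finally have a: "cos \<theta> * sqrt (y\<^sup>2 + S) \<le> y \<longleftrightarrow> sqrt S \<le> y * tan \<theta>" .
    have b: "sqrt (y\<^sup>2 + S) \<le> 1 \<longleftrightarrow> S \<le> 1 - y\<^sup>2" by auto
    have "y \<le> 1" if "S \<le> 1 - y\<^sup>2"
      using that \<open>S \<ge> 0\<close> True power_le_one_iff[of y 2] by auto
    thus ?thesis using True by (auto simp: a b)
  qed auto
  have "emeasure (Rd (Suc m)) C = (\<integral>\<^sup>+ x. indicator C x \<partial>Rd (Suc m))"
    using C by simp
  also have "\<dots> = (\<integral>\<^sup>+ y. \<integral>\<^sup>+ x. indicator C (x(0 := y)) \<partial>Pi\<^sub>M ?A (\<lambda>_. lborel) \<partial>lborel)"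
    unfolding I using C unfolding I by (subst product_nn_integral_insert_rev) auto
  also have "\<dots> = (\<integral>\<^sup>+ y. indicator {0..1} y * ennreal (unit_ball_vol (real m) * ?r y ^ m) \<partial>lborel)"
  proof (intro nn_integral_cong_AE)
    have "AE y in lborel. y \<notin> {0::real, 1}"
      by (intro AE_not_in countable_imp_null_set_lborel) auto
    thus "AE y in lborel. (\<integral>\<^sup>+ x. indicator C (x(0 := y)) \<partial>Pi\<^sub>M ?A (\<lambda>_. lborel)) =
      indicator {0..1} y * ennreal (unit_ball_vol (real m) * ?r y ^ m)"
    proof eventually_elim
      case (elim y)
      let ?B = "{f. sqrt (\<Sum>i\<in>?A. (f i)\<^sup>2) \<le> ?r y} \<inter> space (Pi\<^sub>M ?A (\<lambda>_. lborel :: real measure))"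
      have mem: "x(0 := y) \<in> C \<longleftrightarrow> y \<in> {0<..1} \<and> x \<in> ?B"
        if x: "x \<in> space (Pi\<^sub>M ?A (\<lambda>_. lborel :: real measure))" for x
      proof -
        have n: "norm_d (Suc m) (x(0 := y)) = sqrt (y\<^sup>2 + (\<Sum>i\<in>?A. (x i)\<^sup>2))"
          unfolding norm_d_eq I by (subst sum.insert) (auto intro!: sum.cong)
        have "x(0 := y) \<in> space (Rd (Suc m))"
          using x unfolding I by (auto simp: space_PiM PiE_iff extensional_def)
        thus ?thesis using key[of "\<Sum>i\<in>?A. (x i)\<^sup>2" y] x
          by (simp add: C_def unit_ball_def n sum_nonneg)
      qed
      show ?case
      proof (cases "y \<in> {0<..<1}")
        case True
        have "(\<integral>\<^sup>+ x. indicator C (x(0 := y)) \<partial>Pi\<^sub>M ?A (\<lambda>_. lborel)) =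
            (\<integral>\<^sup>+ x. indicator ?B x \<partial>Pi\<^sub>M ?A (\<lambda>_. lborel))"
          using True mem by (intro nn_integral_cong) (auto simp: indicator_def)
        also have "\<dots> = emeasure (Pi\<^sub>M ?A (\<lambda>_. lborel)) ?B"
          by (intro nn_integral_indicator) measurable
        also have "\<dots> = ennreal (unit_ball_vol (real (card ?A)) * ?r y ^ card ?A)"
          using True tan by (intro emeasure_cball_aux) (auto simp: abs_square_less_1)
        finally show ?thesis using True by simp
      next
        case False
        hence "y \<notin> {0..1}" using elim by auto
        hence "(\<integral>\<^sup>+ x. indicator C (x(0 := y)) \<partial>Pi\<^sub>M ?A (\<lambda>_. lborel)) = (\<integral>\<^sup>+ x. 0 \<partial>Pi\<^sub>M ?A (\<lambda>_. lborel :: real measure))"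
          by (intro nn_integral_cong) (auto simp: mem)
        thus ?thesis using \<open>y \<notin> {0..1}\<close> by simp
      qed
    qed
  qed
  also have "\<dots> = (\<integral>\<^sup>+ y. ennreal (unit_ball_vol (real m) * ?r y ^ m) * indicator {0..1} y \<partial>lborel)"
    by (simp add: mult.commute)
  also have "\<dots> = ennreal (unit_ball_vol (real m) *
           (real m / real (Suc m) * integral {0..\<theta>} (\<lambda>x. sin x ^ (m - 1))))"
    using tan by (intro nn_integral_has_integral_lebesgue' has_integral_mult_right cap_integral assms)
      (auto simp: power_le_one intro!: mult_nonneg_nonneg zero_le_power)
  finally show ?thesis .
qed

lemma cap_area_eq:
  fixes \<theta> :: real
  assumes \<theta>: "0 < \<theta>" "\<theta> < pi / 2" and d: "d \<ge> 2"
  shows "cap_area d \<theta> = 1 / sqrt pi * (Gamma (real d / 2) / Gamma ((real d - 1) / 2)) *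
           integral {0..\<theta>} (\<lambda>x. sin x ^ (d - 2))"
proof -
  obtain m where m: "d = Suc m" "m \<ge> 1" using d by (cases d) auto
  let ?f = "\<lambda>x. \<lambda>i\<in>{..<d}. x i / norm_d d x"
  define I where "I = integral {0..\<theta>} (\<lambda>x. sin x ^ (m - 1))"
  have "I \<ge> 0" unfolding I_def
    using \<theta> by (intro integral_nonneg integrable_continuous_real continuous_intros)
      (auto intro!: zero_le_power sin_ge_zero)
  have cs: "cos \<theta> > 0" using \<theta> by (auto intro: cos_gt_zero)
  have pole: "inner_d d (pole d) y = y 0" for y
  proof -
    have "inner_d d (pole d) y = (\<Sum>i<d. if i = 0 then y i else 0)"
      unfolding inner_d_def pole_def by (intro sum.cong) auto
    thus ?thesis using m by simp
  qed
  have "pole d \<in> space (Rd d)" by (auto simp: pole_def space_PiM)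
  hence K: "spherical_cap d (pole d) \<theta> \<in> sets (Rd d)" by (rule spherical_cap_sets)
  have "{x \<in> unit_ball d. ?f x \<in> spherical_cap d (pole d) \<theta>} =
      {x \<in> unit_ball (Suc m). x 0 > 0 \<and> cos \<theta> * norm_d (Suc m) x \<le> x 0}" (is "?L = ?R")
  proof (intro equalityI subsetI)
    fix x assume x: "x \<in> ?L"
    hence n0: "norm_d d x \<noteq> 0"
      by (auto simp: spherical_cap_def unit_sphere_def norm_d_eq[of d "restrict _ _"])
    have np: "norm_d d x > 0" using n0 by (simp add: norm_d_eq less_le sum_nonneg)
    have "cos \<theta> \<le> inner_d d (pole d) (?f x)" using x by (simp add: spherical_cap_def)
    hence "cos \<theta> \<le> x 0 / norm_d d x" unfolding pole using m by simp
    hence le: "cos \<theta> * norm_d d x \<le> x 0" using np by (simp add: field_simps)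
    moreover have "cos \<theta> * norm_d d x > 0" using cs np by simp
    ultimately show "x \<in> ?R" using x m by auto
  next
    fix x assume x: "x \<in> ?R"
    have "(x 0)\<^sup>2 \<le> (\<Sum>i<d. (x i)\<^sup>2)" using m by (intro member_le_sum) auto
    moreover have "(x 0)\<^sup>2 > 0" using x by simp
    ultimately have "(\<Sum>i<d. (x i)\<^sup>2) > 0" by linarith
    hence n0: "norm_d d x \<noteq> 0" unfolding norm_d_eq by simp
    have np: "norm_d d x > 0" using n0 by (simp add: norm_d_eq less_le sum_nonneg)
    have "x \<in> space (Rd d)" using x m by (auto simp: unit_ball_def)
    note s = normalise_in_sphere[OF this n0]
    have "cos \<theta> \<le> x 0 / norm_d d x" using x m np by (simp add: pos_le_divide_eq)
    hence "cos \<theta> \<le> inner_d d (pole d) (?f x)" unfolding pole using m by simp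
    thus "x \<in> ?L" using x m s by (auto simp: spherical_cap_def)
  qed
  hence "emeasure (sphere_measure d) (spherical_cap d (pole d) \<theta>) =
      ennreal (unit_ball_vol (real m) * (real m / real (Suc m) * I)) / ennreal (unit_ball_vol d)"
    using emeasure_sphere_measure[OF _ K] cone_volume[OF \<theta> m(2)]
    by (simp add: spherical_cap_def I_def m)
  also have "\<dots> = ennreal (unit_ball_vol (real m) * (real m / real (Suc m) * I) / unit_ball_vol d)"
    using \<open>I \<ge> 0\<close> by (intro divide_ennreal) auto
  finally have "cap_area d \<theta> = unit_ball_vol (real m) * (real m / real (Suc m) * I) / unit_ball_vol d"
    using \<open>I \<ge> 0\<close> by (simp add: cap_area_def measure_def)
  also have "\<dots> = (unit_ball_vol (real m) * real m / (real d * unit_ball_vol d)) * I"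
    by (simp add: m)
  also have "unit_ball_vol (real m) * real m / (real d * unit_ball_vol d) =
      1 / sqrt pi * (Gamma (real d / 2) / Gamma ((real d - 1) / 2))"
  proof -
    have g1: "Gamma (real m / 2 + 1) = real m / 2 * Gamma (real m / 2)"
      using m by (intro Gamma_plus1) (auto elim: nonpos_Ints_cases)
    have g2: "Gamma (real d / 2 + 1) = real d / 2 * Gamma (real d / 2)"
      using m by (intro Gamma_plus1) (auto elim: nonpos_Ints_cases)
    have p: "pi powr (real d / 2) = pi powr (real m / 2) * sqrt pi"
      by (simp add: m add_divide_distrib powr_add powr_half_sqrt)
    have h: "(real d - 1) / 2 = real m / 2" using m by simp
    have "Gamma (real m / 2) > 0" "Gamma (real d / 2) > 0" "real m > 0" "real d > 0"
      using m by (auto intro!: Gamma_real_pos)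
    thus ?thesis
      unfolding unit_ball_vol_def g1 g2 p h by simp
  qed
  finally show ?thesis by (simp add: I_def m)
qed

end

theory Submission
  imports Defs "HOL-Real_Asymp.Real_Asymp"
begin

text \<open>
  Why the theorem is true. Put \<open>N\<close> random points on the sphere and join two of them when their angle is
  less than \<open>\<theta>\<close>; codes are independent sets of this conflict graph. If the graph has an independent
  set of size \<open>n\<close> with probability at least \<open>1 / 2\<close>, then a union bound over the \<open>n\<close>-subsets gives
  \<open>(N choose n) * code_prob d \<theta> n \<ge> 1 / 2\<close>, hence \<open>code_prob d \<theta> n / fact n \<ge> 1 / (2 * N ^ n)\<close>
  (\<open>code_prob_lower\<close>). For \<open>N \<le> 1 / (2 * cap_area d (cap_q \<theta>))\<close> this is at least
  \<open>cap_area d (cap_q \<theta>) ^ n\<close>, so the entropy bound holds without an error term. What remains is to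
  find an independent set of size \<open>c * d / cap_area d \<theta>\<close> to first order, where \<open>c = cap_c \<theta>\<close>, in a
  random geometric graph whose number \<open>N\<close> of vertices is only slightly below that threshold, say
  \<open>exp (- \<eta> * d) / cap_area d (cap_q \<theta>)\<close>.

  The degrees of this graph are close to \<open>\<mu> = N * cap_area d \<theta>\<close>, which is about
  \<open>exp ((c - \<eta>) * d)\<close>, because cap areas are exponential in \<open>d\<close> with base the sine of the radius
  (\<open>cap_area_ratio\<close>). Moreover the graph is locally sparse. If \<open>j\<close> is a neighbour of \<open>i\<close>, the
  neighbours of \<open>j\<close> that are at least as close to \<open>i\<close> as \<open>j\<close> is lie in a lens that fits into a cap of
  radius \<open>cap_q \<theta>\<close> (\<open>lens_subset_cap\<close>). Such a cap has an exponentially small mean number of points, so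
  with high probability no lens contains more than a constant number of them. Hence every subset
  of a neighbourhood spans a graph of bounded average degree (\<open>sum_degrees_le_of_rank\<close>).

  A graph with \<open>N\<close> vertices, maximal degree \<open>\<mu>\<close> and such neighbourhoods has an independent set of size
  about \<open>N * ln \<mu> / \<mu>\<close>, the order of magnitude known for triangle-free graphs. The proof
  (\<open>large_independent_set\<close>) estimates the mean size of a random independent set \<open>I\<close> drawn from the
  hard-core model. If the neighbourhood of a vertex is empty with small probability \<open>P\<close>, then it
  contains about \<open>ln (1 / P)\<close> points on average: conditioned on \<open>I\<close> outside the neighbourhood, both
  quantities are governed by the partition function of the sparse graph of those vertices that are
  still free. If \<open>I\<close> is small on average, then the neighbourhoods contain few points on average, so
  they are often empty, and every vertex with an empty neighbourhood has a constant chance of being in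
  \<open>I\<close>. Inserting \<open>ln \<mu> = (c - \<eta>) * d\<close> gives the claimed size.
\<close>

section \<open>The hard-core model on graphs with sparse neighbourhoods\<close>

lemma tangent_ln:
  fixes x u0 :: real
  assumes "x > 0" "u0 > 0"
  shows "ln (1 / u0) + 1 - 1 / (x * u0) \<le> ln x"
proof -
  have "ln (1 / (x * u0)) \<le> 1 / (x * u0) - 1" using assms by (intro ln_le_minus_one) auto
  moreover have "ln (1 / (x * u0)) = ln (1 / u0) - ln x" using assms by (simp add: ln_div ln_mult)
  ultimately show ?thesis by simp
qed

text \<open>
  The hard-core model with fugacity \<open>z\<close> on a graph with adjacency relation \<open>E\<close>: an independent set \<open>I\<close>
  has weight \<open>z ^ card I\<close>. Sums over \<open>I\<close> are left unnormalised, so an expectation is such a sum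
  divided by the partition function \<open>Z\<close>.
\<close>

locale hard_core =
  fixes E :: "'v \<Rightarrow> 'v \<Rightarrow> bool" and z :: real
  assumes sym: "E u v \<Longrightarrow> E v u" and irrefl: "\<not> E u u" and z_pos: "z > 0"
begin

definition indep :: "'v set \<Rightarrow> bool" where
  "indep I \<longleftrightarrow> (\<forall>u\<in>I. \<forall>v\<in>I. \<not> E u v)"

definition Ind :: "'v set \<Rightarrow> 'v set set" where
  "Ind S = {I. I \<subseteq> S \<and> indep I}"

definition nbrs :: "'v set \<Rightarrow> 'v set" where
  "nbrs Y = {u. \<exists>y\<in>Y. E y u}"

definition Z :: "'v set \<Rightarrow> real" where
  "Z S = (\<Sum>I\<in>Ind S. z ^ card I)"

lemma finite_Ind [simp]: "finite S \<Longrightarrow> finite (Ind S)"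
  unfolding Ind_def by (rule finite_subset[of _ "Pow S"]) auto

lemma IndD: "I \<in> Ind S \<Longrightarrow> I \<subseteq> S" "I \<in> Ind S \<Longrightarrow> indep I"
  by (auto simp: Ind_def)

lemma empty_in_Ind [simp]: "{} \<in> Ind S"
  by (auto simp: Ind_def indep_def)

lemma Ind_empty [simp]: "Ind {} = {{}}"
  by (auto simp: Ind_def indep_def)

lemma Ind_mono: "S \<subseteq> T \<Longrightarrow> Ind S \<subseteq> Ind T"
  by (auto simp: Ind_def)

lemma Z_empty [simp]: "Z {} = 1"
  by (simp add: Z_def)

lemma Z_mono: "finite T \<Longrightarrow> S \<subseteq> T \<Longrightarrow> Z S \<le> Z T"
  unfolding Z_def using z_pos by (intro sum_mono2 Ind_mono) auto

lemma Z_ge_1: "finite S \<Longrightarrow> Z S \<ge> 1"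
  using Z_mono[of S "{}"] by simp

lemma Z_pos: "finite S \<Longrightarrow> Z S > 0"
  using Z_ge_1[of S] by linarith

text \<open>
  The spatial Markov property: once the part \<open>Y\<close> of an independent set outside the block \<open>B\<close> is known,
  the part inside is an arbitrary independent set of the vertices of \<open>B\<close> that \<open>Y\<close> leaves free.
\<close>

lemma sum_Ind_split:
  fixes f :: "'v set \<Rightarrow> real"
  assumes "finite V" "B \<subseteq> V"
  shows "(\<Sum>I\<in>Ind V. f I) = (\<Sum>Y\<in>Ind (V - B). \<Sum>J\<in>Ind (B - nbrs Y). f (Y \<union> J))"
proof -
  have fin: "finite B" using assms finite_subset by blast
  have "(\<Sum>Y\<in>Ind (V - B). \<Sum>J\<in>Ind (B - nbrs Y). f (Y \<union> J)) =
      (\<Sum>(Y, J)\<in>(SIGMA Y:Ind (V - B). Ind (B - nbrs Y)). f (Y \<union> J))"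
    using assms fin by (subst sum.Sigma) auto
  also have "\<dots> = (\<Sum>I\<in>Ind V. f I)"
  proof (rule sum.reindex_bij_witness[of _ "\<lambda>I. (I - B, I \<inter> B)" "\<lambda>(Y, J). Y \<union> J"], goal_cases)
    case (1 a)
    then show ?case by (auto simp: Ind_def)
  next
    case (2 a)
    then show ?case using assms(2) sym
      by (auto simp: Ind_def indep_def nbrs_def)  blast+
  next
    case (3 b)
    then show ?case by auto
  next
    case (4 b)
    then show ?case by (auto simp: Ind_def indep_def nbrs_def)
  next
    case (5 a)
    then show ?case by auto
  qed
  finally show ?thesis by simp
qed

lemma card_split:
  assumes "finite V" "B \<subseteq> V" "Y \<in> Ind (V - B)" "J \<in> Ind (B - nbrs Y)"
  shows "card (Y \<union> J) = card Y + card J" "(Y \<union> J) \<inter> B = J"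
proof -
  have "Y \<subseteq> V - B" "J \<subseteq> B" using assms IndD by blast+
  thus "card (Y \<union> J) = card Y + card J" "(Y \<union> J) \<inter> B = J"
    using assms by (auto intro!: card_Un_disjoint finite_subset[of Y V] finite_subset[of J V])
qed

lemma Z_split:
  assumes "finite V" "B \<subseteq> V"
  shows "Z V = (\<Sum>Y\<in>Ind (V - B). z ^ card Y * Z (B - nbrs Y))"
proof -
  have "Z V = (\<Sum>Y\<in>Ind (V - B). \<Sum>J\<in>Ind (B - nbrs Y). z ^ card (Y \<union> J))"
    unfolding Z_def by (rule sum_Ind_split[OF assms])
  also have "\<dots> = (\<Sum>Y\<in>Ind (V - B). \<Sum>J\<in>Ind (B - nbrs Y). z ^ card Y * z ^ card J)"
    by (intro sum.cong refl) (simp add: card_split[OF assms] power_add)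
  finally show ?thesis by (simp add: Z_def sum_distrib_left)
qed

lemma mean_size_split:
  assumes "finite V" "B \<subseteq> V"
  shows "(\<Sum>I\<in>Ind V. z ^ card I * card (I \<inter> B)) =
    (\<Sum>Y\<in>Ind (V - B). z ^ card Y * (\<Sum>J\<in>Ind (B - nbrs Y). z ^ card J * card J))"
proof -
  have "(\<Sum>I\<in>Ind V. z ^ card I * card (I \<inter> B)) =
     (\<Sum>Y\<in>Ind (V - B). \<Sum>J\<in>Ind (B - nbrs Y). z ^ card (Y \<union> J) * card ((Y \<union> J) \<inter> B))"
    by (rule sum_Ind_split[OF assms])
  also have "\<dots> = (\<Sum>Y\<in>Ind (V - B). \<Sum>J\<in>Ind (B - nbrs Y). z ^ card Y * (z ^ card J * card J))"
    by (intro sum.cong refl) (simp only: card_split[OF assms] power_add mult.assoc)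
  finally show ?thesis by (simp add: sum_distrib_left)
qed

lemma sum_through_vertex:
  assumes "finite S" "u \<in> S"
  shows "(\<Sum>I\<in>{I\<in>Ind S. u \<in> I}. z ^ card I) = z * Z (S - {u} - nbrs {u})"
proof -
  have "(\<Sum>I\<in>{I\<in>Ind S. u \<in> I}. z ^ card I) = (\<Sum>J\<in>Ind (S - {u} - nbrs {u}). z * z ^ card J)"
  proof (rule sum.reindex_bij_witness[of _ "insert u" "\<lambda>I. I - {u}"], goal_cases)
    case (1 a)
    then show ?case by auto
  next
    case (2 a)
    then show ?case by (auto simp: Ind_def indep_def nbrs_def)
  next
    case (3 b)
    then show ?case by (auto simp: Ind_def)
  next
    case (4 b)
    then show ?case using assms sym irrefl
      by (auto simp: Ind_def indep_def nbrs_def)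
  next
    case (5 a)
    hence "finite a" using assms IndD(1) finite_subset by blast
    then show ?case using 5 by (simp add: card_Diff_singleton flip: power_Suc)
       (metis Suc_pred card_gt_0_iff empty_iff power_Suc)
  qed
  thus ?thesis by (simp add: Z_def sum_distrib_left)
qed

lemma Z_delete_vertex:
  assumes "finite S" "u \<in> S"
  shows "Z S = Z (S - {u}) + z * Z (S - {u} - nbrs {u})"
proof -
  have "Ind S = Ind (S - {u}) \<union> {I\<in>Ind S. u \<in> I}" by (auto simp: Ind_def)
  hence "Z S = (\<Sum>I\<in>Ind (S - {u}) \<union> {I\<in>Ind S. u \<in> I}. z ^ card I)" unfolding Z_def by simp
  also have "\<dots> = Z (S - {u}) + (\<Sum>I\<in>{I\<in>Ind S. u \<in> I}. z ^ card I)"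
    unfolding Z_def using assms by (subst sum.union_disjoint) (auto dest: IndD(1))
  finally show ?thesis using sum_through_vertex[OF assms] by simp
qed

text \<open>
  Deleting a vertex at most divides the partition function by \<open>1 + z\<close>, because the independent sets
  that use the vertex inject into those that do not.
\<close>

lemma Z_le_delete:
  assumes "finite S" "finite D"
  shows "Z S \<le> (1 + z) ^ card D * Z (S - D)"
  using assms(2)
proof induction
  case (insert u D)
  have "Z (S - D) \<le> (1 + z) * Z (S - D - {u})"
  proof (cases "u \<in> S - D")
    case True
    have "Z (S - D - {u} - nbrs {u}) \<le> Z (S - D - {u})" using assms by (intro Z_mono) auto
    thus ?thesis using Z_delete_vertex[of "S - D" u] True assms(1) z_pos
      by (simp add: algebra_simps)
  next
    case False
    have "0 < Z (S - D)" using assms(1) by (intro Z_pos) auto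
    thus ?thesis using False z_pos by (simp add: algebra_simps)
  qed
  hence "(1 + z) ^ card D * Z (S - D) \<le> (1 + z) ^ card D * ((1 + z) * Z (S - D - {u}))"
    using z_pos by (intro mult_left_mono) auto
  moreover have "S - D - {u} = S - insert u D" by auto
  ultimately show ?case using insert by (simp add: algebra_simps)
qed simp

lemma mean_size_eq:
  assumes "finite S"
  shows "(\<Sum>I\<in>Ind S. z ^ card I * card I) = (\<Sum>u\<in>S. z * Z (S - {u} - nbrs {u}))"
proof -
  have "(\<Sum>I\<in>Ind S. z ^ card I * card I) = (\<Sum>I\<in>Ind S. \<Sum>u\<in>S. if u \<in> I then z ^ card I else 0)"
  proof (intro sum.cong refl)
    fix I assume "I \<in> Ind S"
    hence "S \<inter> I = I" using IndD(1) by blast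
    thus "z ^ card I * real (card I) = (\<Sum>u\<in>S. if u \<in> I then z ^ card I else 0)"
      using assms by (simp add: sum.If_cases)
  qed
  also have "\<dots> = (\<Sum>u\<in>S. \<Sum>I\<in>Ind S. if u \<in> I then z ^ card I else 0)" by (rule sum.swap)
  also have "\<dots> = (\<Sum>u\<in>S. \<Sum>I\<in>{I\<in>Ind S. u \<in> I}. z ^ card I)"
    using assms by (intro sum.cong refl sum.inter_filter[symmetric]) simp
  finally show ?thesis using sum_through_vertex[OF assms] by simp
qed

text \<open>
  On a sparse graph the hard-core model is close to independent percolation: a vertex \<open>u\<close> is occupied
  with probability at least \<open>z\<close> times \<open>(1 + z) ^ -(deg u + 1)\<close>, so the mean size is about
  \<open>z * card T\<close>, and that is an upper bound for \<open>ln (Z T)\<close>. The hypothesis \<open>sparse\<close> bounds the average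
  degree, and only the average enters.
\<close>

lemma mean_size_ge_Z_ln_Z:
  assumes T: "finite T" and sparse: "(\<Sum>u\<in>T. card (T \<inter> nbrs {u})) \<le> 2 * K * card T"
    and small: "z * (2 * real K + 1) \<le> 1"
  shows "(1 - z * (2 * real K + 1)) * (Z T * ln (Z T)) \<le> (\<Sum>J\<in>Ind T. z ^ card J * card J)"
proof -
  define \<kappa> where "\<kappa> = 1 - z * (2 * real K + 1)"
  have \<kappa>: "\<kappa> \<ge> 0" using small by (simp add: \<kappa>_def)
  have ZT: "Z T > 0" using T by (rule Z_pos)
  have "Z T \<le> (1 + z) ^ card T" using Z_le_delete[OF T T] by simp
  also have "\<dots> \<le> exp z ^ card T" using z_pos by (intro power_mono exp_ge_add_one_self) auto
  finally have "Z T \<le> exp (z * card T)" by (simp add: exp_of_nat2_mult)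
  hence lnZ: "ln (Z T) \<le> z * card T" using ZT by (metis ln_exp ln_le_cancel_iff exp_gt_zero)
  \<comment> \<open>deleting the closed neighbourhood of \<open>u\<close> costs one factor \<open>1 + z \<le> exp z\<close> per vertex\<close>
  have point: "(1 - z * (card (T \<inter> nbrs {u}) + 1)) * Z T \<le> Z (T - {u} - nbrs {u})" if "u \<in> T" for u
  proof -
    let ?D = "insert u (T \<inter> nbrs {u})"
    have c: "card ?D = card (T \<inter> nbrs {u}) + 1"
      using T irrefl by (subst card_insert_disjoint) (auto simp: nbrs_def)
    have "Z T \<le> (1 + z) ^ card ?D * Z (T - ?D)" using T by (intro Z_le_delete) auto
    also have "T - ?D = T - {u} - nbrs {u}" by auto
    finally have le: "Z T \<le> (1 + z) ^ card ?D * Z (T - {u} - nbrs {u})" .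
    have Zp: "Z (T - {u} - nbrs {u}) > 0" using T by (intro Z_pos) auto
    have "(1 + z) ^ card ?D \<le> exp z ^ card ?D" using z_pos by (intro power_mono exp_ge_add_one_self) auto
    hence e: "(1 + z) ^ card ?D \<le> exp (z * card ?D)" by (simp add: exp_of_nat2_mult)
    have "(1 - z * card ?D) * Z T \<le> exp (- (z * card ?D)) * Z T"
      using exp_ge_add_one_self[of "- (z * card ?D)"] ZT by (intro mult_right_mono) auto
    also have "\<dots> \<le> exp (- (z * card ?D)) * (exp (z * card ?D) * Z (T - {u} - nbrs {u}))"
      using le e Zp by (intro mult_left_mono) (auto intro: order.trans mult_right_mono)
    also have "\<dots> = Z (T - {u} - nbrs {u})" by (simp add: exp_minus)
    finally show ?thesis by (simp add: c)
  qed
  have "\<kappa> * (Z T * ln (Z T)) \<le> \<kappa> * (Z T * (z * card T))"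
    using \<kappa> ZT lnZ by (intro mult_left_mono) auto
  also have "\<dots> = z * Z T * (card T - z * (2 * K * card T + card T))"
    by (simp add: \<kappa>_def algebra_simps)
  also have "\<dots> \<le> z * Z T * (card T - z * ((\<Sum>u\<in>T. card (T \<inter> nbrs {u})) + card T))"
    using ZT z_pos of_nat_mono[OF sparse, where 'a = real] by (intro mult_left_mono diff_left_mono) auto
  also have "\<dots> = (\<Sum>u\<in>T. z * ((1 - z * (card (T \<inter> nbrs {u}) + 1)) * Z T))"
    by (simp add: sum_distrib_left sum_distrib_right sum_subtractf sum.distrib algebra_simps)
  also have "\<dots> \<le> (\<Sum>u\<in>T. z * Z (T - {u} - nbrs {u}))"
    using point z_pos by (intro sum_mono mult_left_mono) auto
  finally show ?thesis using mean_size_eq[OF T] by (simp add: \<kappa>_def)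
qed

text \<open>
  Given the configuration \<open>Y\<close> outside \<open>B\<close>, the mean number of points in \<open>B\<close> is at least a constant
  times \<open>ln (Z T)\<close> with \<open>T = B - nbrs Y\<close>, and \<open>1 / Z T\<close> is the probability that \<open>B\<close> stays empty.
  Averaging over \<open>Y\<close> by Jensen's inequality would bound the mean number of points in \<open>B\<close> below by the
  logarithm of \<open>1 / P\<close>, where \<open>P = Z (V - B) / Z V\<close> is the probability that \<open>B\<close> is empty. As
  \<open>ln x\<close> is convex in \<open>1 / x\<close>, its tangent at \<open>1 / x = u0\<close> can replace Jensen's inequality; this leaves
  a bound linear in \<open>P\<close>, which can then be summed over many blocks.
\<close>

lemma mean_size_in_block:
  assumes V: "finite V" "B \<subseteq> V" and small: "z * (2 * real K + 1) \<le> 1" and u0: "u0 > 0"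
    and sparse: "\<And>T. T \<subseteq> B \<Longrightarrow> (\<Sum>u\<in>T. card (T \<inter> nbrs {u})) \<le> 2 * K * card T"
  shows "(1 - z * (2 * real K + 1)) * (Z V * (ln (1 / u0) + 1) - Z (V - B) / u0)
           \<le> (\<Sum>I\<in>Ind V. z ^ card I * card (I \<inter> B))"
proof -
  define \<kappa> where "\<kappa> = 1 - z * (2 * real K + 1)"
  have \<kappa>: "\<kappa> \<ge> 0" using small by (simp add: \<kappa>_def)
  have fin: "finite (B - nbrs Y)" for Y using V finite_subset by blast
  have "Z V * (ln (1 / u0) + 1) - Z (V - B) / u0 =
     (\<Sum>Y\<in>Ind (V - B). z ^ card Y * (Z (B - nbrs Y) * (ln (1 / u0) + 1) - 1 / u0))"
    unfolding Z_split[OF V] Z_def[of "V - B"]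
    by (simp add: sum_distrib_left sum_distrib_right sum_subtractf sum_divide_distrib sum.distrib algebra_simps)
  also have "\<dots> \<le> (\<Sum>Y\<in>Ind (V - B). z ^ card Y * (Z (B - nbrs Y) * ln (Z (B - nbrs Y))))"
  proof (intro sum_mono mult_left_mono)
    fix Y
    have Zp: "Z (B - nbrs Y) > 0" using fin by (rule Z_pos)
    have "Z (B - nbrs Y) * (ln (1 / u0) + 1 - 1 / (Z (B - nbrs Y) * u0)) \<le>
        Z (B - nbrs Y) * ln (Z (B - nbrs Y))"
      using tangent_ln[OF Zp u0] Zp by (intro mult_left_mono) auto
    thus "Z (B - nbrs Y) * (ln (1 / u0) + 1) - 1 / u0 \<le> Z (B - nbrs Y) * ln (Z (B - nbrs Y))"
      using Zp by (simp add: right_diff_distrib)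
  qed (use z_pos in auto)
  finally have "\<kappa> * (Z V * (ln (1 / u0) + 1) - Z (V - B) / u0) \<le>
      \<kappa> * (\<Sum>Y\<in>Ind (V - B). z ^ card Y * (Z (B - nbrs Y) * ln (Z (B - nbrs Y))))"
    using \<kappa> by (rule mult_left_mono)
  also have "\<dots> = (\<Sum>Y\<in>Ind (V - B). z ^ card Y * (\<kappa> * (Z (B - nbrs Y) * ln (Z (B - nbrs Y)))))"
    by (simp add: sum_distrib_left algebra_simps)
  also have "\<dots> \<le> (\<Sum>Y\<in>Ind (V - B). z ^ card Y * (\<Sum>J\<in>Ind (B - nbrs Y). z ^ card J * card J))"
    unfolding \<kappa>_def using z_pos fin sparse small by (intro sum_mono mult_left_mono mean_size_ge_Z_ln_Z) auto
  finally show ?thesis using mean_size_split[OF V] by (simp add: \<kappa>_def)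
qed

text \<open>
  A vertex \<open>v\<close> is occupied with probability \<open>z / (1 + z)\<close> times the probability \<open>P\<^sub>v\<close> that its
  neighbourhood is empty. If the mean size of the random independent set were small, then so would be
  most \<open>P\<^sub>v\<close>; but then the neighbourhoods would contain many points on average, about \<open>ln (1 / P\<^sub>v)\<close>
  each, while double counting shows that these numbers sum to at most \<open>D\<close> times the mean size.
  With \<open>u0\<close> a constant multiple of \<open>1 / D\<close> the two effects balance at a mean size of about \<open>card V * ln D / D\<close>,
  and some independent set is at least as large as the mean.
\<close>

lemma large_independent_set:
  fixes K D :: nat and \<kappa> u0 :: real
  assumes V: "finite V"
    and small: "z * (2 * real K + 1) \<le> 1" and u0: "u0 > 0"
    and deg: "\<And>v. v \<in> V \<Longrightarrow> card (V \<inter> nbrs {v}) \<le> D"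
    and sparse: "\<And>v T. v \<in> V \<Longrightarrow> T \<subseteq> V \<inter> nbrs {v} \<Longrightarrow>
      (\<Sum>u\<in>T. card (T \<inter> nbrs {u})) \<le> 2 * K * card T"
  defines "\<kappa> \<equiv> 1 - z * (2 * real K + 1)"
  shows "\<exists>I\<in>Ind V. \<kappa> * card V * (ln (1 / u0) + 1) \<le> card I * (D + \<kappa> * (1 + z) / (z * u0))"
proof -
  let ?N = "\<lambda>v. V \<inter> nbrs {v}"
  define W where "W = (\<Sum>I\<in>Ind V. z ^ card I * card I)"
  have \<kappa>: "\<kappa> \<ge> 0" using small by (simp add: \<kappa>_def)
  have ZV: "Z V > 0" using V by (rule Z_pos)
  \<comment> \<open>\<open>Z (V - ?N v) / Z V\<close> is the probability that the neighbourhood of \<open>v\<close> is empty\<close>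
  have W_eq: "W = (\<Sum>v\<in>V. z / (1 + z) * Z (V - ?N v))"
    unfolding W_def mean_size_eq[OF V]
  proof (intro sum.cong refl)
    fix v assume v: "v \<in> V"
    have "v \<notin> nbrs {v}" using irrefl by (auto simp: nbrs_def)
    hence "Z (V - ?N v) = (1 + z) * Z (V - {v} - nbrs {v})"
      using Z_delete_vertex[of "V - ?N v" v] V v
      by (simp add: Diff_Int Diff_insert2 algebra_simps set_diff_eq)
         (smt (verit, best) Collect_cong)
    thus "z * Z (V - {v} - nbrs {v}) = z / (1 + z) * Z (V - ?N v)" using z_pos by simp
  qed
  have "\<kappa> * (card V * (Z V * (ln (1 / u0) + 1)) - (1 + z) / (z * u0) * W) =
      (\<Sum>v\<in>V. \<kappa> * (Z V * (ln (1 / u0) + 1) - Z (V - ?N v) / u0))"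
    unfolding W_eq using z_pos u0
    by (simp add: sum_subtractf sum_distrib_left[symmetric] sum_divide_distrib[symmetric])
  also have "\<dots> \<le> (\<Sum>v\<in>V. \<Sum>I\<in>Ind V. z ^ card I * card (I \<inter> ?N v))"
    unfolding \<kappa>_def using V u0 small sparse by (intro sum_mono mean_size_in_block) auto
  also have "\<dots> = (\<Sum>I\<in>Ind V. z ^ card I * (\<Sum>v\<in>V. card (I \<inter> ?N v)))"
    by (subst sum.swap) (simp add: sum_distrib_left)
  also have "\<dots> \<le> (\<Sum>I\<in>Ind V. z ^ card I * (D * card I))"
  proof (intro sum_mono mult_left_mono)
    fix I assume "I \<in> Ind V"
    hence I: "I \<subseteq> V" "finite I" using IndD(1) V finite_subset by blast+
    \<comment> \<open>count the edges between \<open>I\<close> and \<open>V\<close> from the side of \<open>I\<close>\<close>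
    have "(\<Sum>v\<in>V. card (I \<inter> ?N v)) = (\<Sum>v\<in>V. \<Sum>u\<in>I. if E v u then 1 else 0)"
      using I by (intro sum.cong refl) (simp add: sum.If_cases nbrs_def Int_def, metis subsetD)
    also have "\<dots> = (\<Sum>u\<in>I. \<Sum>v\<in>V. if E v u then 1 else 0)" by (rule sum.swap)
    also have "\<dots> = (\<Sum>u\<in>I. card (?N u))"
      using V by (intro sum.cong refl) (simp add: sum.If_cases nbrs_def Int_def, metis sym)
    also have "\<dots> \<le> (\<Sum>u\<in>I. D)" using deg I by (intro sum_mono) auto
    finally have "(\<Sum>v\<in>V. card (I \<inter> ?N v)) \<le> D * card I" by (simp add: mult.commute)
    thus "real (\<Sum>v\<in>V. card (I \<inter> ?N v)) \<le> real (D * card I)" by (rule of_nat_mono)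
  qed (use z_pos in auto)
  also have "\<dots> = D * W" by (simp add: W_def sum_distrib_left algebra_simps)
  finally have "\<kappa> * (card V * (Z V * (ln (1 / u0) + 1))) \<le> W * (D + \<kappa> * (1 + z) / (z * u0))"
    by (simp add: algebra_simps)
  hence main: "(\<kappa> * card V * (ln (1 / u0) + 1)) * Z V \<le> W * (D + \<kappa> * (1 + z) / (z * u0))"
    by (simp add: algebra_simps)
  define X where "X = \<kappa> * card V * (ln (1 / u0) + 1)"
  define Q where "Q = D + \<kappa> * (1 + z) / (z * u0)"
  show ?thesis
  proof (rule ccontr)
    assume "\<not> ?thesis"
    hence lt: "card I * Q < X" if "I \<in> Ind V" for I using that by (force simp: X_def Q_def)
    have "W * Q = (\<Sum>I\<in>Ind V. z ^ card I * (card I * Q))"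
      by (simp add: W_def sum_distrib_left sum_distrib_right algebra_simps)
    also have "\<dots> < (\<Sum>I\<in>Ind V. z ^ card I * X)"
      using z_pos lt V by (intro sum_strict_mono) (auto intro: empty_in_Ind)
    also have "\<dots> = X * Z V" by (simp add: Z_def sum_distrib_left algebra_simps)
    finally show False using main by (simp add: X_def Q_def)
  qed
qed

text \<open>
  Every edge is counted at its end of lower rank; this is how a bounded number of neighbours in one
  direction of the order bounds the average degree of all subgraphs.
\<close>

lemma sum_degrees_le_of_rank:
  fixes f :: "'v \<Rightarrow> real"
  assumes T: "finite T" and K: "\<And>u. u \<in> T \<Longrightarrow> card {w\<in>T. E u w \<and> f u \<le> f w} \<le> K"
  shows "(\<Sum>u\<in>T. card (T \<inter> nbrs {u})) \<le> 2 * K * card T"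
proof -
  have "(\<Sum>u\<in>T. card (T \<inter> nbrs {u})) \<le>
      (\<Sum>u\<in>T. card {w\<in>T. E u w \<and> f u \<le> f w} + card {w\<in>T. E u w \<and> f w \<le> f u})"
  proof (intro sum_mono)
    fix u
    have "T \<inter> nbrs {u} \<subseteq> {w\<in>T. E u w \<and> f u \<le> f w} \<union> {w\<in>T. E u w \<and> f w \<le> f u}"
      by (auto simp: nbrs_def)
    hence "card (T \<inter> nbrs {u}) \<le> card ({w\<in>T. E u w \<and> f u \<le> f w} \<union> {w\<in>T. E u w \<and> f w \<le> f u})"
      using T by (intro card_mono) auto
    also have "\<dots> \<le> card {w\<in>T. E u w \<and> f u \<le> f w} + card {w\<in>T. E u w \<and> f w \<le> f u}" by (rule card_Un_le)
    finally show "card (T \<inter> nbrs {u}) \<le> card {w\<in>T. E u w \<and> f u \<le> f w} + card {w\<in>T. E u w \<and> f w \<le> f u}" .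
  qed
  also have "(\<Sum>u\<in>T. card {w\<in>T. E u w \<and> f u \<le> f w} + card {w\<in>T. E u w \<and> f w \<le> f u}) =
      (\<Sum>u\<in>T. card {w\<in>T. E u w \<and> f u \<le> f w}) + (\<Sum>u\<in>T. card {w\<in>T. E u w \<and> f w \<le> f u})"
    by (rule sum.distrib)
  also have "(\<Sum>u\<in>T. card {w\<in>T. E u w \<and> f w \<le> f u}) =
      (\<Sum>u\<in>T. \<Sum>w\<in>T. if E u w \<and> f w \<le> f u then 1 else 0)"
    using T by (intro sum.cong refl) (simp add: sum.If_cases Int_def)
  also have "\<dots> = (\<Sum>w\<in>T. \<Sum>u\<in>T. if E u w \<and> f w \<le> f u then 1 else 0)" by (rule sum.swap)
  also have "\<dots> = (\<Sum>w\<in>T. card {u\<in>T. E w u \<and> f w \<le> f u})"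
    using T sym by (intro sum.cong refl) (auto simp: sum.If_cases Int_def intro!: arg_cong[where f = card])
  finally have "(\<Sum>u\<in>T. card (T \<inter> nbrs {u})) \<le> 2 * (\<Sum>u\<in>T. card {w\<in>T. E u w \<and> f u \<le> f w})" by simp
  also have "\<dots> \<le> 2 * (\<Sum>u\<in>T. K)" using K by (intro mult_left_mono sum_mono) auto
  finally show ?thesis by (simp add: mult_ac)
qed

end

section \<open>Tail bounds for the number of points in a random set\<close>

text \<open>
  The number of points among the \<open>x k\<close>, \<open>k \<in> J\<close>, that fall in a random set determined by the remaining
  points \<open>x k\<close>, \<open>k \<in> D\<close>. Given the latter it is a sum of independent indicators of mean at most \<open>p\<close>, and
  Markov's inequality for \<open>(1 + t) ^ count\<close> gives Chernoff's bound. The free parameter \<open>t\<close> allows for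
  both regimes that occur: counts close to a huge mean (\<open>t\<close> small) and counts far above a tiny one
  (\<open>t\<close> huge).
\<close>

lemma binomial_tail:
  fixes p t :: real and m :: nat
  assumes M: "prob_space M" and fin: "finite D" "finite J" and disj: "D \<inter> J = {}"
    and R: "Measurable.pred (Pi\<^sub>M D (\<lambda>_. M) \<Otimes>\<^sub>M M) (\<lambda>(x, y). R x y)"
    and p: "\<forall>x\<in>space (Pi\<^sub>M D (\<lambda>_. M)). measure M {y \<in> space M. R x y} \<le> p"
    and t: "t \<ge> 0"
  shows "{x \<in> space (Pi\<^sub>M (D \<union> J) (\<lambda>_. M)). m \<le> card {k\<in>J. R (restrict x D) (x k)}}
           \<in> sets (Pi\<^sub>M (D \<union> J) (\<lambda>_. M))" (is "?A \<in> _")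
    and "measure (Pi\<^sub>M (D \<union> J) (\<lambda>_. M))
           {x \<in> space (Pi\<^sub>M (D \<union> J) (\<lambda>_. M)). m \<le> card {k\<in>J. R (restrict x D) (x k)}}
           \<le> exp (t * p * card J) / (1 + t) ^ m"
proof -
  interpret M: prob_space M by fact
  interpret product_sigma_finite "\<lambda>_. M" by standard
  interpret PD: prob_space "Pi\<^sub>M D (\<lambda>_. M)" by (intro prob_space_PiM M)
  interpret PDJ: prob_space "Pi\<^sub>M (D \<union> J) (\<lambda>_. M)" by (intro prob_space_PiM M)
  let ?P = "Pi\<^sub>M (D \<union> J) (\<lambda>_. M)"
  define g where "g x y = (if R x y then 1 + t else 1)" for x y
  have Rk [measurable]: "Measurable.pred ?P (\<lambda>x. R (restrict x D) (x k))" if "k \<in> J" for k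
  proof -
    have "(\<lambda>x. (restrict x D, x k)) \<in> measurable ?P (Pi\<^sub>M D (\<lambda>_. M) \<Otimes>\<^sub>M M)"
      using that by (intro measurable_Pair measurable_restrict_subset measurable_component_singleton) auto
    from measurable_compose[OF this R] show ?thesis by simp
  qed
  have card_eq: "real (card {k\<in>J. R (restrict x D) (x k)}) = (\<Sum>k\<in>J. if R (restrict x D) (x k) then 1 else 0)" for x
    using fin by (simp add: sum.If_cases Int_def)
  have "(\<lambda>x. \<Sum>k\<in>J. if R (restrict x D) (x k) then 1 else 0 :: real) \<in> borel_measurable ?P"
    by (intro borel_measurable_sum measurable_If Rk) auto
  hence cm: "(\<lambda>x. real (card {k\<in>J. R (restrict x D) (x k)})) \<in> borel_measurable ?P"
    by (simp add: card_eq)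
  have "?A = {x \<in> space ?P. real m \<le> real (card {k\<in>J. R (restrict x D) (x k)})}" by simp
  also have "\<dots> \<in> sets ?P" using cm by measurable
  finally show A: "?A \<in> sets ?P" .
  let ?f = "\<lambda>x. \<Prod>k\<in>J. ennreal (g (restrict x D) (x k))"
  have f: "?f \<in> borel_measurable ?P"
    unfolding g_def by (intro borel_measurable_prod_ennreal measurable_compose[OF _ measurable_ennreal] measurable_If Rk) auto
  have markov: "ennreal ((1 + t) ^ m) * indicator ?A x \<le> ?f x" for x
  proof (cases "x \<in> ?A")
    case True
    have "(\<Prod>k\<in>J. g (restrict x D) (x k)) = (\<Prod>k\<in>{k\<in>J. R (restrict x D) (x k)}. 1 + t)"
      unfolding g_def using fin by (simp add: prod.If_cases Int_def)
    also have "\<dots> = (1 + t) ^ card {k\<in>J. R (restrict x D) (x k)}" by simp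
    also have "\<dots> \<ge> (1 + t) ^ m" using True t by (intro power_increasing) auto
    finally have "ennreal ((1 + t) ^ m) \<le> ennreal (\<Prod>k\<in>J. g (restrict x D) (x k))" by (rule ennreal_leI)
    also have "\<dots> = ?f x" using t by (subst prod_ennreal) (auto simp: g_def)
    finally show ?thesis using True by simp
  qed simp
  have inner: "(\<integral>\<^sup>+ y. ennreal (g x y) \<partial>M) \<le> ennreal (exp (t * p))"
    if x: "x \<in> space (Pi\<^sub>M D (\<lambda>_. M))" for x
  proof -
    have Rx: "Measurable.pred M (R x)"
      using measurable_compose[OF measurable_Pair1'[OF x] R] by simp
    define S where "S = {y\<in>space M. R x y}"
    have S [measurable]: "S \<in> sets M" using Rx by (simp add: S_def pred_def)
    have "(\<integral>\<^sup>+ y. ennreal (g x y) \<partial>M) = (\<integral>\<^sup>+ y. 1 + ennreal t * indicator S y \<partial>M)"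
      using t by (intro nn_integral_cong) (auto simp: g_def S_def ennreal_plus)
    also have "\<dots> = 1 + ennreal t * emeasure M S"
      by (subst nn_integral_add) (auto simp: nn_integral_cmult M.emeasure_space_1)
    also have "\<dots> = ennreal (1 + t * measure M {y\<in>space M. R x y})"
      using t by (simp add: M.emeasure_eq_measure ennreal_mult ennreal_plus S_def)
    also have "\<dots> \<le> ennreal (1 + t * p)"
      using p x t by (intro ennreal_leI add_left_mono mult_left_mono) auto
    also have "\<dots> \<le> ennreal (exp (t * p))" by (intro ennreal_leI exp_ge_add_one_self)
    finally show ?thesis .
  qed
  have "ennreal ((1 + t) ^ m) * emeasure ?P ?A = (\<integral>\<^sup>+ x. ennreal ((1 + t) ^ m) * indicator ?A x \<partial>?P)"
    using A by (simp add: nn_integral_cmult)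
  also have "\<dots> \<le> (\<integral>\<^sup>+ x. ?f x \<partial>?P)" by (intro nn_integral_mono markov)
  also have "\<dots> = (\<integral>\<^sup>+ x. \<integral>\<^sup>+ y. ?f (merge D J (x, y)) \<partial>Pi\<^sub>M J (\<lambda>_. M) \<partial>Pi\<^sub>M D (\<lambda>_. M))"
    by (intro product_nn_integral_fold disj fin f)
  also have "\<dots> \<le> (\<integral>\<^sup>+ x. ennreal (exp (t * p * card J)) \<partial>Pi\<^sub>M D (\<lambda>_. M))"
  proof (intro nn_integral_mono)
    fix x assume x: "x \<in> space (Pi\<^sub>M D (\<lambda>_. M))"
    have gx: "(\<lambda>y. ennreal (g x y)) \<in> borel_measurable M"
    proof -
      have Rx: "Measurable.pred M (R x)"
        using measurable_compose[OF measurable_Pair1'[OF x] R] by simp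
      show ?thesis unfolding g_def
        by (intro measurable_compose[OF _ measurable_ennreal] measurable_If Rx[unfolded pred_def]) auto
    qed
    have "(\<integral>\<^sup>+ y. ?f (merge D J (x, y)) \<partial>Pi\<^sub>M J (\<lambda>_. M)) =
        (\<integral>\<^sup>+ y. (\<Prod>k\<in>J. ennreal (g x (y k))) \<partial>Pi\<^sub>M J (\<lambda>_. M))"
    proof (intro nn_integral_cong prod.cong refl)
      fix y k assume k: "k \<in> J"
      have "restrict (merge D J (x, y)) D = x" using x
        by (auto simp: space_PiM PiE_iff extensional_def fun_eq_iff merge_def)
      moreover have "merge D J (x, y) k = y k" using k disj by (auto simp: merge_def)
      ultimately show "ennreal (g (restrict (merge D J (x, y)) D) (merge D J (x, y) k)) = ennreal (g x (y k))"
        by simp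
    qed
    also have "\<dots> = (\<integral>\<^sup>+ y. ennreal (g x y) \<partial>M) ^ card J"
      using gx by (subst product_nn_integral_prod[OF fin(2)]) auto
    also have "\<dots> \<le> ennreal (exp (t * p)) ^ card J" by (intro power_mono inner x) auto
    also have "\<dots> = ennreal (exp (t * p * card J))" by (simp add: ennreal_power exp_of_nat2_mult)
    finally show "(\<integral>\<^sup>+ y. ?f (merge D J (x, y)) \<partial>Pi\<^sub>M J (\<lambda>_. M)) \<le> ennreal (exp (t * p * card J))" .
  qed
  also have "\<dots> = ennreal (exp (t * p * card J))" by (simp add: PD.emeasure_space_1)
  finally have "ennreal ((1 + t) ^ m * measure ?P ?A) \<le> ennreal (exp (t * p * card J))"
    using t by (simp add: PDJ.emeasure_eq_measure ennreal_mult)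
  hence "(1 + t) ^ m * measure ?P ?A \<le> exp (t * p * card J)" by (simp add: ennreal_le_iff)
  moreover have "(1 + t) ^ m > 0" using t by simp
  ultimately show "measure ?P ?A \<le> exp (t * p * card J) / (1 + t) ^ m"
    by (simp add: pos_le_divide_eq mult.commute)
qed

section \<open>Rotation invariance of cap areas\<close>

text \<open>
  Only the two properties that transport cap areas are required; reflections are included.
\<close>

definition rotation :: "nat \<Rightarrow> ((nat \<Rightarrow> real) \<Rightarrow> nat \<Rightarrow> real) \<Rightarrow> bool" where
  "rotation d g \<longleftrightarrow> g \<in> measurable (Rd d) (Rd d) \<and> distr (Rd d) (Rd d) g = Rd d \<and>
     (\<forall>y z. inner_d d (g y) (g z) = inner_d d y z)"

lemma component_measurable [measurable]:
  "i < d \<Longrightarrow> (\<lambda>x. x i) \<in> borel_measurable (Rd d)"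
  using measurable_component_singleton[of i "{..<d}" "\<lambda>_. lborel :: real measure"] by simp

lemma shear_measurable:
  assumes "i < d" "j < d"
  shows "(\<lambda>x. x(i := \<sigma> * x i + a * x j)) \<in> measurable (Rd d) (Rd d)"
proof (rule measurable_PiM_single')
  fix k assume k: "k \<in> {..<d}"
  show "(\<lambda>x. (x(i := \<sigma> * x i + a * x j)) k) \<in> measurable (Rd d) lborel"
    using assms k by (cases "k = i") auto
next
  show "(\<lambda>x. x(i := \<sigma> * x i + a * x j)) \<in> space (Rd d) \<rightarrow> {..<d} \<rightarrow>\<^sub>E space lborel"
    using assms by (auto simp: space_PiM PiE_iff extensional_def)
qed

text \<open>
  Integrating first over the coordinate \<open>i\<close> makes the map a translation or a reflected translation of
  the line.
\<close>

lemma shear_preserves: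
  assumes ij: "i < d" "j < d" "i \<noteq> j" and \<sigma>: "\<bar>\<sigma>\<bar> = 1"
  shows "distr (Rd d) (Rd d) (\<lambda>x. x(i := \<sigma> * x i + a * x j)) = Rd d"
proof (rule measure_eqI)
  fix A assume "A \<in> sets (distr (Rd d) (Rd d) (\<lambda>x. x(i := \<sigma> * x i + a * x j)))"
  hence A: "A \<in> sets (Rd d)" by simp
  interpret product_sigma_finite "\<lambda>_. lborel :: real measure" by standard
  let ?g = "\<lambda>x. x(i := \<sigma> * x i + a * x j)" and ?I = "{..<d} - {i}"
  have I: "{..<d} = insert i ?I" using ij by auto
  have mA: "indicator A \<in> borel_measurable (Rd d)" using A by simp
  have mg: "(\<lambda>x. indicator A (?g x)) \<in> borel_measurable (Rd d)"
    using measurable_compose[OF shear_measurable[OF ij(1,2)] mA] .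
  have "emeasure (distr (Rd d) (Rd d) ?g) A = (\<integral>\<^sup>+ x. indicator A x \<partial>distr (Rd d) (Rd d) ?g)"
    using A by simp
  also have "\<dots> = (\<integral>\<^sup>+ x. indicator A (?g x) \<partial>Rd d)"
    using A by (intro nn_integral_distr shear_measurable ij mA) auto
  also have "\<dots> = (\<integral>\<^sup>+ x. \<integral>\<^sup>+ y. indicator A (?g (x(i := y))) \<partial>lborel \<partial>Pi\<^sub>M ?I (\<lambda>_. lborel))"
    by (subst I, rule product_nn_integral_insert) (use mg I in auto)
  also have "\<dots> = (\<integral>\<^sup>+ x. \<integral>\<^sup>+ y. indicator A (x(i := y)) \<partial>lborel \<partial>Pi\<^sub>M ?I (\<lambda>_. lborel))"
  proof (rule nn_integral_cong)
    fix x assume x: "x \<in> space (Pi\<^sub>M ?I (\<lambda>_. lborel :: real measure))"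
    have "(\<lambda>y. x(i := y)) \<in> measurable lborel (Pi\<^sub>M (insert i ?I) (\<lambda>_. lborel :: real measure))"
      using x by (intro measurable_component_update) auto
    hence "(\<lambda>y. x(i := y)) \<in> measurable lborel (Rd d)" using I by simp
    from measurable_compose[OF this mA]
    have m: "(\<lambda>y. indicator A (x(i := y)) :: ennreal) \<in> borel_measurable borel" by simp
    have "(\<integral>\<^sup>+ y. indicator A (x(i := y)) \<partial>lborel) =
        ennreal \<bar>\<sigma>\<bar> * (\<integral>\<^sup>+ y. indicator A (x(i := a * x j + \<sigma> * y)) \<partial>lborel)"
      using \<sigma> by (intro nn_integral_real_affine m) auto
    also have "\<dots> = (\<integral>\<^sup>+ y. indicator A (?g (x(i := y))) \<partial>lborel)"
      using \<sigma> ij by (simp add: add.commute)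
    finally show "(\<integral>\<^sup>+ y. indicator A (?g (x(i := y))) \<partial>lborel) = (\<integral>\<^sup>+ y. indicator A (x(i := y)) \<partial>lborel)" ..
  qed
  also have "\<dots> = (\<integral>\<^sup>+ x. indicator A x \<partial>Rd d)"
    by (subst (2) I, rule product_nn_integral_insert[symmetric]) (use mA I in auto)
  finally show "emeasure (distr (Rd d) (Rd d) ?g) A = emeasure (Rd d) A" using A by simp
qed simp

lemma preserves_comp:
  assumes "f \<in> measurable (Rd d) (Rd d)" "distr (Rd d) (Rd d) f = Rd d"
    and "g \<in> measurable (Rd d) (Rd d)" "distr (Rd d) (Rd d) g = Rd d"
  shows "g \<circ> f \<in> measurable (Rd d) (Rd d)" "distr (Rd d) (Rd d) (g \<circ> f) = Rd d"
  using assms distr_distr[OF assms(3,1)] by (auto intro: measurable_comp)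

lemma rotation_comp: "rotation d f \<Longrightarrow> rotation d g \<Longrightarrow> rotation d (g \<circ> f)"
  unfolding rotation_def using preserves_comp[of f d g] by simp

lemma rotation_id: "rotation d (\<lambda>x. x)"
  by (simp add: rotation_def distr_id2)

lemma sum_two:
  fixes f :: "nat \<Rightarrow> real"
  assumes "i < d" "j < d" "i \<noteq> j"
  shows "(\<Sum>k<d. f k) = f i + f j + (\<Sum>k\<in>{..<d} - {i, j}. f k)"
proof -
  have "(\<Sum>k<d. f k) = (\<Sum>k\<in>{i, j}. f k) + (\<Sum>k\<in>{..<d} - {i, j}. f k)"
    using assms by (subst sum.subset_diff[of "{i, j}"]) auto
  thus ?thesis using assms by simp
qed

text \<open>
  A rotation by an angle \<open>\<phi>\<close> is a product of three shears with slopes \<open>-\<tau>\<close>, \<open>s\<close>, \<open>-\<tau>\<close>, where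
  \<open>\<tau> = tan (\<phi> / 2)\<close>. This reduces its invariance to that of one coordinate at a time.
\<close>

lemma plane_rotation:
  assumes ij: "i < d" "j < d" "i \<noteq> j" and cs: "c\<^sup>2 + s\<^sup>2 = 1" "s \<noteq> 0"
  shows "rotation d (\<lambda>x. x(i := c * x i - s * x j, j := s * x i + c * x j))"
proof -
  define \<tau> where "\<tau> = (1 - c) / s"
  let ?f = "\<lambda>x :: nat \<Rightarrow> real. x(i := 1 * x i + (- \<tau>) * x j)"
  let ?h = "\<lambda>x :: nat \<Rightarrow> real. x(j := 1 * x j + s * x i)"
  let ?r = "\<lambda>x :: nat \<Rightarrow> real. x(i := c * x i - s * x j, j := s * x i + c * x j)"
  have ts: "\<tau> * s = 1 - c" using cs by (simp add: \<tau>_def)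
  have "s * (\<tau> * (1 + c)) = (\<tau> * s) * (1 + c)" by simp
  also have "\<dots> = 1 - c\<^sup>2" unfolding ts by (simp add: power2_eq_square algebra_simps)
  also have "\<dots> = s * s" using cs(1) by (simp add: power2_eq_square)
  finally have "s * (\<tau> * (1 + c)) = s * s" .
  hence tc: "\<tau> * (1 + c) = s" using cs by simp
  have r: "?r = ?f \<circ> (?h \<circ> ?f)"
  proof
    fix x :: "nat \<Rightarrow> real"
    have "1 * x j + s * (1 * x i + - \<tau> * x j) = s * x i + (1 - \<tau> * s) * x j" by (simp add: algebra_simps)
    hence 1: "1 * x j + s * (1 * x i + - \<tau> * x j) = s * x i + c * x j" using ts by simp
    have "x i - \<tau> * x j - \<tau> * (s * x i + c * x j) = (1 - \<tau> * s) * x i - (\<tau> * (1 + c)) * x j"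
      by (simp add: algebra_simps)
    hence 2: "x i - \<tau> * x j - \<tau> * (s * x i + c * x j) = c * x i - s * x j" using ts tc by simp
    show "?r x = (?f \<circ> (?h \<circ> ?f)) x"
      using ij 1 2 by (auto simp: fun_eq_iff)
  qed
  have f: "?f \<in> measurable (Rd d) (Rd d)" "distr (Rd d) (Rd d) ?f = Rd d"
    using ij by (intro shear_measurable shear_preserves; simp)+
  have h: "?h \<in> measurable (Rd d) (Rd d)" "distr (Rd d) (Rd d) ?h = Rd d"
    using ij by (intro shear_measurable shear_preserves; simp)+
  have "?r \<in> measurable (Rd d) (Rd d)" "distr (Rd d) (Rd d) ?r = Rd d"
    unfolding r by (intro preserves_comp f h)+
  moreover have "inner_d d (?r y) (?r z) = inner_d d y z" for y z
  proof -
    have "(c * y i - s * y j) * (c * z i - s * z j) + (s * y i + c * y j) * (s * z i + c * z j) =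
        (c\<^sup>2 + s\<^sup>2) * (y i * z i + y j * z j)" by (simp add: power2_eq_square algebra_simps)
    moreover have "(\<Sum>k\<in>{..<d} - {i, j}. ?r y k * ?r z k) = (\<Sum>k\<in>{..<d} - {i, j}. y k * z k)"
      by (intro sum.cong) auto
    ultimately show ?thesis unfolding inner_d_def sum_two[OF ij] using ij cs by simp
  qed
  ultimately show ?thesis by (simp add: rotation_def)
qed

lemma rotation_flip:
  assumes "d \<ge> 2"
  shows "rotation d (\<lambda>x. x(0 := - x 0))"
proof -
  let ?g = "\<lambda>x :: nat \<Rightarrow> real. x(0 := - 1 * x 0 + 0 * x 1)"
  have "?g \<in> measurable (Rd d) (Rd d)" "distr (Rd d) (Rd d) ?g = Rd d"
    using assms by (intro shear_measurable shear_preserves; simp)+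
  moreover have "inner_d d (x(0 := - x 0)) (y(0 := - y 0)) = inner_d d x y" for x y
    unfolding inner_d_def by (intro sum.cong) auto
  ultimately show ?thesis by (simp add: rotation_def)
qed

text \<open>
  Givens rotations in the planes \<open>(0, j)\<close> kill the coordinates \<open>j\<close> one after the other.
\<close>

lemma rotate_to_zero:
  assumes "finite J" "J \<subseteq> {1..<d}"
  shows "\<exists>g. rotation d g \<and> (\<forall>j\<in>J. g x j = 0)"
  using assms
proof induction
  case empty
  show ?case using rotation_id by auto
next
  case (insert j J)
  then obtain g where g: "rotation d g" "\<forall>j\<in>J. g x j = 0" by auto
  show ?case
  proof (cases "g x j = 0")
    case True
    thus ?thesis using g by auto
  next
    case False
    define r where "r = sqrt ((g x 0)\<^sup>2 + (g x j)\<^sup>2)"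
    have r2: "r\<^sup>2 = (g x 0)\<^sup>2 + (g x j)\<^sup>2" by (simp add: r_def)
    have "r\<^sup>2 > 0" unfolding r2 using False by (simp add: sum_power2_gt_zero_iff)
    hence r: "r \<noteq> 0" by auto
    define c s where "c = g x 0 / r" and "s = - g x j / r"
    have "c\<^sup>2 + s\<^sup>2 = ((g x 0)\<^sup>2 + (g x j)\<^sup>2) / r\<^sup>2"
      by (simp add: c_def s_def power_divide add_divide_distrib)
    hence cs: "c\<^sup>2 + s\<^sup>2 = 1" "s \<noteq> 0" using r False by (auto simp: r2[symmetric] s_def)
    have j: "0 < d" "j < d" "0 \<noteq> j" using insert by auto
    let ?h = "\<lambda>x :: nat \<Rightarrow> real. x(0 := c * x 0 - s * x j, j := s * x 0 + c * x j)"
    have "?h (g x) j = 0" by (simp add: c_def s_def)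
    moreover have "?h (g x) k = 0" if "k \<in> J" for k
    proof -
      have "k \<noteq> 0" "k \<noteq> j" using that insert by auto
      thus ?thesis using that g by simp
    qed
    ultimately have "\<forall>k\<in>insert j J. (?h \<circ> g) x k = 0" by auto
    moreover have "rotation d (?h \<circ> g)"
      using rotation_comp[OF g(1) plane_rotation[OF j cs]] .
    ultimately show ?thesis by blast
  qed
qed

lemma rotate_to_pole:
  assumes d: "d \<ge> 2" and x: "x \<in> unit_sphere d"
  shows "\<exists>g. rotation d g \<and> g x = pole d"
proof -
  obtain g where g: "rotation d g" "\<forall>j\<in>{1..<d}. g x j = 0"
    using rotate_to_zero[of "{1..<d}" d x] by auto
  have xs: "x \<in> space (Rd d)" "inner_d d x x = 1" using x by (auto simp: unit_sphere_def norm_d_def)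
  have I: "{..<d} = insert 0 {1..<d}" using d by auto
  have "inner_d d (g x) (g x) = (g x 0)\<^sup>2"
    unfolding inner_d_def I using g by (simp add: power2_eq_square)
  hence "(g x 0)\<^sup>2 = 1" using g xs by (simp add: rotation_def)
  hence cases: "g x 0 = 1 \<or> g x 0 = - 1" by (simp add: power2_eq_1_iff)
  have gx: "g x \<in> space (Rd d)" using g xs by (auto simp: rotation_def dest: measurable_space)
  show ?thesis
  proof (cases "g x 0 = 1")
    case True
    have "g x = pole d" using gx g(2) True
      by (auto simp: pole_def fun_eq_iff space_PiM PiE_iff extensional_def Ball_def)
    thus ?thesis using g by blast
  next
    case False
    have "(g x)(0 := - g x 0) = pole d" using gx g(2) False cases d
      by (auto simp: pole_def fun_eq_iff space_PiM PiE_iff extensional_def Ball_def)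
    hence "((\<lambda>x. x(0 := - x 0)) \<circ> g) x = pole d" by simp
    thus ?thesis using rotation_comp[OF g(1) rotation_flip[OF d]] by blast
  qed
qed

lemma pole_in_sphere: "d \<ge> 1 \<Longrightarrow> pole d \<in> unit_sphere d"
proof -
  assume d: "d \<ge> 1"
  have "(\<Sum>i<d. (pole d i)\<^sup>2) = (\<Sum>i<d. if i = 0 then 1 else 0)"
    by (intro sum.cong) (auto simp: pole_def)
  hence "(\<Sum>i<d. (pole d i)\<^sup>2) = 1" using d by simp
  thus "pole d \<in> unit_sphere d" by (simp add: unit_sphere_def norm_d_eq pole_def space_PiM)
qed

text \<open>
  Caps of the same radius are related by an isometry that preserves volume, and the isometry commutes
  with the radial projection that defines the measure on the sphere.
\<close>

lemma cap_measure:
  assumes d: "d \<ge> 2" and x: "x \<in> unit_sphere d"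
  shows "measure (sphere_measure d) (spherical_cap d x \<theta>) = cap_area d \<theta>"
proof -
  let ?f = "\<lambda>x. \<lambda>i\<in>{..<d}. x i / norm_d d x"
  let ?C = "\<lambda>x. {y \<in> unit_ball d. ?f y \<in> spherical_cap d x \<theta>}"
  obtain g where g: "rotation d g" "g x = pole d" using rotate_to_pole[OF assms] by blast
  have gm: "g \<in> measurable (Rd d) (Rd d)" using g by (simp add: rotation_def)
  have inn: "inner_d d (g y) (g z) = inner_d d y z" for y z using g by (simp add: rotation_def)
  have nrm: "norm_d d (g y) = norm_d d y" for y by (simp add: norm_d_def inn)
  have scale: "inner_d d u (?f y) = inner_d d u y / norm_d d y" for u y
    by (simp add: inner_d_def sum_divide_distrib)
  have nf: "norm_d d (?f y) = (if norm_d d y = 0 then 0 else 1)" if "y \<in> space (Rd d)" for y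
    using normalise_in_sphere[OF that]
    by (auto simp: unit_sphere_def norm_d_eq[of d "restrict _ _"])
  have fs: "?f y \<in> space (Rd d)" for y by (auto simp: space_PiM)
  have gs: "g y \<in> space (Rd d)" if "y \<in> space (Rd d)" for y
    using gm that by (auto dest: measurable_space)
  have eq: "?C x = g -` ?C (pole d) \<inter> space (Rd d)"
  proof (intro set_eqI)
    fix y
    show "y \<in> ?C x \<longleftrightarrow> y \<in> g -` ?C (pole d) \<inter> space (Rd d)"
    proof (cases "y \<in> space (Rd d)")
      case True
      have "inner_d d (pole d) (?f (g y)) = inner_d d x (?f y)"
        unfolding scale unfolding nrm g(2)[symmetric] inn ..
      thus ?thesis using True gs[OF True] fs nf[OF True] nf[OF gs[OF True]] nrm
        by (simp add: unit_ball_def spherical_cap_def unit_sphere_def)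
    qed (auto simp: unit_ball_def)
  qed
  have xs: "x \<in> space (Rd d)" "pole d \<in> space (Rd d)"
    using x pole_in_sphere[of d] d by (auto simp: unit_sphere_def)
  have Cs: "?C u \<in> sets (Rd d)" if "u \<in> space (Rd d)" for u
  proof -
    have "?C u = unit_ball d \<inter> (?f -` spherical_cap d u \<theta> \<inter> space (Rd d))"
      by (auto simp: unit_ball_def)
    thus ?thesis
      using measurable_sets[OF normalise_measurable spherical_cap_sets[OF that]] unit_ball_sets by simp
  qed
  have "emeasure (Rd d) (?C x) = emeasure (distr (Rd d) (Rd d) g) (?C (pole d))"
    unfolding eq by (intro emeasure_distr[symmetric] gm Cs xs)
  also have "\<dots> = emeasure (Rd d) (?C (pole d))" using g by (simp add: rotation_def)
  finally have "emeasure (sphere_measure d) (spherical_cap d x \<theta>) =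
      emeasure (sphere_measure d) (spherical_cap d (pole d) \<theta>)"
    using xs by (simp add: emeasure_sphere_measure spherical_cap_sets spherical_cap_def)
  thus ?thesis by (simp add: cap_area_def measure_def)
qed

section \<open>Lenses inside caps\<close>

lemma cos_cap_q:
  assumes \<theta>: "0 < \<theta>" "\<theta> < pi / 2"
  shows "cos (cap_q \<theta>) = sqrt (2 * (cos \<theta>)\<^sup>2 / (1 + cos \<theta>))"
    and "0 < cap_q \<theta>" "cap_q \<theta> < \<theta>" 
proof -
  define b where "b = cos \<theta>"
  define R where "R = sqrt ((cos \<theta> - 1)\<^sup>2 * (1 + 2 * cos \<theta>)) / sin \<theta>"
  have b: "0 < b" "b < 1" using \<theta> cos_gt_zero[of \<theta>] cos_monotone_0_pi[of 0 \<theta>] by (auto simp: b_def)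
  have s: "sin \<theta> > 0" "(sin \<theta>)\<^sup>2 = (1 - b) * (1 + b)" 
    using \<theta> sin_gt_zero[of \<theta>] by (auto simp: b_def sin_squared_eq power2_eq_square algebra_simps)
  have "(b - 1)\<^sup>2 * (1 + 2 * b) > 0" using b by simp
  hence R0: "R > 0" using s by (simp add: R_def b_def)
  have "R\<^sup>2 = (b - 1)\<^sup>2 * (1 + 2 * b) / (sin \<theta>)\<^sup>2"
    using b by (simp add: R_def power_divide b_def[symmetric])
  also have "\<dots> = ((1 - b) * ((1 - b) * (1 + 2 * b))) / ((1 - b) * (1 + b))"
    unfolding s by (simp add: power2_eq_square algebra_simps)
  also have "\<dots> = (1 - b) * (1 + 2 * b) / (1 + b)" using b by (intro mult_divide_mult_cancel_left) auto
  finally have R2: "R\<^sup>2 = (1 - b) * (1 + 2 * b) / (1 + b)" .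
  have "1 - R\<^sup>2 = 2 * b\<^sup>2 / (1 + b)"
    unfolding R2 using b by (simp add: field_simps power2_eq_square)
  hence c2: "1 - R\<^sup>2 = 2 * (cos \<theta>)\<^sup>2 / (1 + cos \<theta>)" by (simp add: b_def)
  have "1 + 2 * b < (1 + b) * (1 + b)" using b by (simp add: algebra_simps)
  hence "(1 - b) * (1 + 2 * b) < (1 - b) * ((1 + b) * (1 + b))" using b by (intro mult_strict_left_mono) auto
  hence "R\<^sup>2 < (1 - b) * (1 + b)"
    unfolding R2 using b by (simp add: pos_divide_less_eq mult.assoc)
  hence "R\<^sup>2 < (sin \<theta>)\<^sup>2" by (simp add: s)
  hence Rs: "R < sin \<theta>" using s(1) power_less_imp_less_base[of R 2 "sin \<theta>"] by auto
  have R1: "R < 1" using Rs sin_le_one[of \<theta>] by linarith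
  have q: "cap_q \<theta> = arcsin R" by (simp add: cap_q_def R_def)
  show "cos (cap_q \<theta>) = sqrt (2 * (cos \<theta>)\<^sup>2 / (1 + cos \<theta>))"
    unfolding q c2[symmetric] using R0 R1 by (intro cos_arcsin) auto
  show "0 < cap_q \<theta>" unfolding q using R0 R1 arcsin_less_mono[of 0 R] by simp
  have "arcsin R < arcsin (sin \<theta>)" using R0 R1 Rs sin_le_one[of \<theta>] by (intro arcsin_less_arcsin) auto
  thus "cap_q \<theta> < \<theta>" unfolding q using \<theta> by (simp add: arcsin_sin)
qed

lemma inner_d_commute: "inner_d d x y = inner_d d y x"
  by (simp add: inner_d_def mult.commute)

text \<open>
  Every point of the lens satisfies \<open>cos \<theta> + \<langle>x, y\<rangle> \<le> \<langle>x + y, w\<rangle>\<close>, so the lens lies in a cap about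
  the midpoint of \<open>x\<close> and \<open>y\<close>. The cosine of its radius, \<open>(a + b) / sqrt (2 + 2 * a)\<close> for
  \<open>a = \<langle>x, y\<rangle>\<close> and \<open>b = cos \<theta>\<close>, increases with \<open>a\<close>, so the worst case is \<open>a = b\<close>, where the radius
  is \<open>cap_q \<theta>\<close>.
\<close>

lemma lens_subset_cap:
  assumes \<theta>: "0 < \<theta>" "\<theta> < pi / 2"
    and x: "x \<in> unit_sphere d" and y: "y \<in> unit_sphere d" and xy: "cos \<theta> \<le> inner_d d x y"
  shows "\<exists>z\<in>unit_sphere d. {w \<in> unit_sphere d. cos \<theta> \<le> inner_d d y w \<and> inner_d d x y \<le> inner_d d x w}
           \<subseteq> spherical_cap d z (cap_q \<theta>)"
proof -
  define a b where "a = inner_d d x y" and "b = cos \<theta>"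
  have b: "0 < b" "b \<le> a" using \<theta> cos_gt_zero[of \<theta>] xy by (auto simp: a_def b_def)
  let ?v = "\<lambda>i\<in>{..<d}. x i + y i"
  have inn: "inner_d d w ?v = inner_d d w x + inner_d d w y" for w
    by (simp add: inner_d_def sum.distrib algebra_simps)
  have xx: "inner_d d x x = 1" "inner_d d y y = 1" using x y by (auto simp: unit_sphere_def norm_d_def)
  have "inner_d d ?v ?v = 2 + 2 * a"
    unfolding inn inner_d_commute[of d ?v] using xx by (simp add: a_def inner_d_commute)
  hence n: "norm_d d ?v = sqrt (2 + 2 * a)" by (simp add: norm_d_def)
  have n0: "norm_d d ?v > 0" unfolding n using b by simp
  let ?z = "\<lambda>i\<in>{..<d}. ?v i / norm_d d ?v"
  have "?v \<in> space (Rd d)" by (simp add: space_PiM)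
  hence z: "?z \<in> unit_sphere d" using n0 by (intro normalise_in_sphere) linarith+
  have zw: "inner_d d ?z w = (inner_d d x w + inner_d d y w) / norm_d d ?v" for w
    by (simp add: inner_d_def sum.distrib add_divide_distrib sum_divide_distrib algebra_simps)
  have "2 * b\<^sup>2 * (2 + 2 * a) \<le> (1 + b) * (a + b)\<^sup>2"
  proof -
    \<comment> \<open>the difference of the two sides vanishes at \<open>a = b\<close>, which gives the factor \<open>a - b\<close>\<close>
    have "0 \<le> (a - b) * (b * (a - b) + a + 3 * b)" using b by (intro mult_nonneg_nonneg add_nonneg_nonneg) auto
    also have "\<dots> \<le> (1 + b) * (a + b)\<^sup>2 - 2 * b\<^sup>2 * (2 + 2 * a)"
      using b by (simp add: power2_eq_square algebra_simps)
    finally show ?thesis by simp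
  qed
  hence "2 * b\<^sup>2 / (1 + b) \<le> (a + b)\<^sup>2 / (2 + 2 * a)" using b by (simp add: field_simps)
  hence "sqrt (2 * b\<^sup>2 / (1 + b)) \<le> sqrt ((a + b)\<^sup>2 / (2 + 2 * a))" by simp
  hence cq: "cos (cap_q \<theta>) \<le> (a + b) / norm_d d ?v"
    using b cos_cap_q[OF \<theta>] by (simp add: n real_sqrt_divide b_def)
  have "w \<in> spherical_cap d ?z (cap_q \<theta>)"
    if w: "w \<in> unit_sphere d" "cos \<theta> \<le> inner_d d y w" "inner_d d x y \<le> inner_d d x w" for w
  proof -
    have "(a + b) / norm_d d ?v \<le> inner_d d ?z w"
      unfolding zw using w n0 by (intro divide_right_mono) (auto simp: a_def b_def)
    thus ?thesis using cq w by (simp add: spherical_cap_def)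
  qed
  thus ?thesis using z by blast
qed

section \<open>Exponential rates of cap areas\<close>

text \<open>
  Log-convexity at three points with spacing \<open>1 / 2\<close>; the outer two are related by the functional
  equation of \<open>Gamma\<close>.
\<close>

lemma Gamma_ratio_ge_1:
  assumes "d \<ge> 5"
  shows "Gamma (real d / 2) / Gamma ((real d - 1) / 2) \<ge> 1"
proof -
  define x where "x = (real d - 1) / 2"
  have x: "x \<ge> 2" using assms by (simp add: x_def)
  have G: "Gamma (x - 1/2) > 0" "Gamma x > 0" "Gamma (x + 1/2) > 0" using x by (auto intro!: Gamma_real_pos)
  have "(ln \<circ> Gamma) ((1 - 1/2) *\<^sub>R (x - 1/2) + (1/2) *\<^sub>R (x + 1/2)) \<le>
      (1 - 1/2) * (ln \<circ> Gamma) (x - 1/2) + (1/2) * (ln \<circ> Gamma) (x + 1/2)"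
    using x by (intro convex_onD[OF log_convex_Gamma_real]) auto
  hence "ln (Gamma x) \<le> ln (Gamma (x - 1/2)) / 2 + ln (Gamma (x + 1/2)) / 2"
    by (simp add: algebra_simps)
  moreover have "Gamma (x + 1/2) = (x - 1/2) * Gamma (x - 1/2)"
  proof -
    have "x - 1/2 \<notin> \<int>\<^sub>\<le>\<^sub>0" using x by (auto elim!: nonpos_Ints_cases)
    moreover have "x - 1/2 + 1 = x + 1/2" by simp
    ultimately show ?thesis using Gamma_plus1[of "x - 1/2"] by metis
  qed
  hence "ln (Gamma (x + 1/2)) = ln (x - 1/2) + ln (Gamma (x - 1/2))" using x G(1) by (simp add: ln_mult less_imp_neq[symmetric])
  moreover have "ln (x - 1/2) \<ge> 0" using x by (intro ln_ge_zero) auto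
  ultimately have "ln (Gamma x) \<le> ln (Gamma (x + 1/2))" by linarith
  hence "Gamma x \<le> Gamma (x + 1/2)" using G by simp
  moreover have e: "real d / 2 = x + 1/2" by (simp add: x_def field_simps)
  ultimately show ?thesis unfolding e x_def[symmetric] using G by simp
qed

lemma integral_sin_power_le:
  assumes "0 \<le> q" "q \<le> pi / 2"
  shows "integral {0..q} (\<lambda>x. sin x ^ m) \<le> q * sin q ^ m"
proof -
  have "integral {0..q} (\<lambda>x. sin x ^ m) \<le> integral {0..q} (\<lambda>x. sin q ^ m)"
    using assms by (intro integral_le integrable_continuous_real continuous_intros)
      (auto intro!: power_mono sin_monotone_2pi_le sin_ge_zero)
  thus ?thesis using assms by simp
qed

lemma integral_sin_power_ge:
  assumes "0 \<le> a" "a \<le> q" "q \<le> pi / 2"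
  shows "(q - a) * sin a ^ m \<le> integral {0..q} (\<lambda>x. sin x ^ m)"
proof -
  have "(q - a) * sin a ^ m = integral {a..q} (\<lambda>x. sin a ^ m)" using assms by simp
  also have "\<dots> \<le> integral {a..q} (\<lambda>x. sin x ^ m)"
    using assms by (intro integral_le integrable_continuous_real continuous_intros)
      (auto intro!: power_mono sin_monotone_2pi_le sin_ge_zero)
  also have "\<dots> \<le> integral {0..q} (\<lambda>x. sin x ^ m)"
    using assms by (intro integral_subset_le integrable_continuous_real continuous_intros)
      (auto intro!: zero_le_power sin_ge_zero)
  finally show ?thesis .
qed

lemma cap_area_lower:
  assumes \<theta>: "0 < \<theta>" "\<theta> < pi / 2"
  shows "\<exists>C>0. \<forall>\<^sub>F d in sequentially. exp (- C * real d) \<le> cap_area d \<theta>"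
proof -
  define s where "s = sin (\<theta> / 2)"
  have s: "0 < s" "s \<le> 1" using \<theta> sin_gt_zero[of "\<theta> / 2"] by (auto simp: s_def)
  \<comment> \<open>with \<open>r\<close> below the constant prefactor as well, one power \<open>r ^ d\<close> bounds the whole area\<close>
  define r where "r = min (1/2) (min s (\<theta> / 2 / sqrt pi))"
  have r: "0 < r" "r < 1" "r \<le> s" "r \<le> \<theta> / 2 / sqrt pi" using \<theta> s by (auto simp: r_def)
  have "exp (- (- ln r) * real d) \<le> cap_area d \<theta>" if d: "d \<ge> 5" for d
  proof -
    define m where "m = d - 2"
    have "exp (- (- ln r) * real d) = r ^ d" using r by (simp add: exp_of_nat2_mult)
    also have "\<dots> \<le> r ^ Suc m" using r d by (intro power_decreasing) (auto simp: m_def)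
    also have "\<dots> = r * r ^ m" by simp
    also have "\<dots> \<le> (\<theta> / 2 / sqrt pi) * s ^ m"
      using r \<theta> by (intro mult_mono power_mono) auto
    also have "\<dots> = 1 / sqrt pi * ((\<theta> - \<theta> / 2) * sin (\<theta> / 2) ^ m)" by (simp add: s_def)
    also have "\<dots> \<le> 1 / sqrt pi * integral {0..\<theta>} (\<lambda>x. sin x ^ m)"
      using \<theta> by (intro mult_left_mono integral_sin_power_ge) auto
    also have "\<dots> \<le> 1 / sqrt pi * (Gamma (real d / 2) / Gamma ((real d - 1) / 2)) * integral {0..\<theta>} (\<lambda>x. sin x ^ m)"
    proof (intro mult_right_mono)
      show "0 \<le> integral {0..\<theta>} (\<lambda>x. sin x ^ m)"
        using \<theta> by (intro integral_nonneg integrable_continuous_real continuous_intros)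
          (auto intro!: zero_le_power sin_ge_zero)
      show "1 / sqrt pi \<le> 1 / sqrt pi * (Gamma (real d / 2) / Gamma ((real d - 1) / 2))"
        using mult_left_mono[OF Gamma_ratio_ge_1[OF d], of "1 / sqrt pi"] by simp
    qed
    also have "\<dots> = cap_area d \<theta>" using cap_area_eq[OF \<theta>, of d] d by (simp add: m_def)
    finally show ?thesis .
  qed
  moreover have "- ln r > 0" using r by simp
  ultimately show ?thesis by (intro exI[of _ "- ln r"] conjI eventually_sequentiallyI[of 5]) auto
qed

text \<open>
  The integral up to an angle \<open>q < pi / 2\<close> grows like \<open>sin q ^ d\<close> up to factors that are not exponential
  in \<open>d\<close>; the normalising factors of the two areas cancel.
\<close>

lemma cap_area_ratio:
  assumes q: "0 < q" "q < \<theta>" "\<theta> < pi / 2" and \<eta>: "\<eta> > 0"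
  shows "\<forall>\<^sub>F d in sequentially. cap_area d q * exp ((ln (sin \<theta> / sin q) - \<eta>) * real d) \<le> cap_area d \<theta>"
proof -
  have sq: "0 < sin q" using q by (intro sin_gt_zero) auto
  have s\<theta>: "0 < sin \<theta>" using q by (intro sin_gt_zero) auto
  define c where "c = ln (sin \<theta> / sin q)"
  \<comment> \<open>an angle \<open>a\<close> below \<open>\<theta>\<close> that already has the growth rate of \<open>\<theta>\<close> up to \<open>\<eta> / 2\<close>; the other half
    of \<open>\<eta>\<close> absorbs the factor \<open>q / (\<theta> - a)\<close> and the shift from \<open>d\<close> to \<open>d - 2\<close>, collected in \<open>D\<close>\<close>
  have "((\<lambda>a. ln (sin a / sin q)) \<longlongrightarrow> c) (at_left \<theta>)"
    unfolding c_def using sq s\<theta> by (intro tendsto_intros) auto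
  hence "\<forall>\<^sub>F a in at_left \<theta>. ln (sin a / sin q) > c - \<eta> / 2"
    using \<eta> by (intro order_tendstoD) auto
  moreover have "\<forall>\<^sub>F a in at_left \<theta>. a \<in> {q<..<\<theta>}" using q by (intro eventually_at_left_real) auto
  ultimately have "\<forall>\<^sub>F a in at_left \<theta>. a \<in> {q<..<\<theta>} \<and> ln (sin a / sin q) > c - \<eta> / 2"
    by eventually_elim auto
  then obtain a where a: "q < a" "a < \<theta>" "ln (sin a / sin q) > c - \<eta> / 2"
    using eventually_happens[of _ "at_left \<theta>"] by force
  have sa: "0 < sin a" using a q by (intro sin_gt_zero) auto
  define L where "L = ln (sin a / sin q)"
  define D where "D = ln (q / (\<theta> - a)) + 2 * L"
  have "\<forall>\<^sub>F d in sequentially. real d \<ge> D / (\<eta> / 2)"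
    by (intro eventually_ge_at_top filterlim_real_sequentially[THEN filterlim_at_top[THEN iffD1, rule_format]])
  moreover have "\<forall>\<^sub>F d :: nat in sequentially. d \<ge> 2" by (rule eventually_ge_at_top)
  ultimately have "\<forall>\<^sub>F d in sequentially. cap_area d q * exp ((c - \<eta>) * real d) \<le> cap_area d \<theta>"
  proof eventually_elim
    case (elim d)
    define m where "m = d - 2"
    define G where "G = 1 / sqrt pi * (Gamma (real d / 2) / Gamma ((real d - 1) / 2))"
    have G: "G \<ge> 0" unfolding G_def using elim
      by (intro mult_nonneg_nonneg divide_nonneg_nonneg less_imp_le[OF Gamma_real_pos]) auto
    have "(sin a / sin q) ^ m = exp (L * m)" using sa sq by (simp add: L_def exp_of_nat2_mult)
    hence pw: "sin a ^ m = sin q ^ m * exp (L * m)" using sq by (simp add: power_divide field_simps)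
    have "D \<le> \<eta> / 2 * d" using elim \<eta> by (simp add: divide_le_eq mult.commute)
    moreover have "(c - \<eta> / 2) * d \<le> L * d" using a(3) by (intro mult_right_mono) (auto simp: L_def)
    ultimately have "ln (q / (\<theta> - a)) + (c - \<eta>) * d \<le> L * d - 2 * L"
      by (simp add: D_def algebra_simps)
    also have "\<dots> = L * m" using elim by (simp add: m_def algebra_simps)
    finally have "exp (ln (q / (\<theta> - a)) + (c - \<eta>) * d) \<le> exp (L * m)" by simp
    hence "q / (\<theta> - a) * exp ((c - \<eta>) * d) \<le> exp (L * m)" using q a by (simp add: exp_add)
    hence e: "q * exp ((c - \<eta>) * d) \<le> (\<theta> - a) * exp (L * m)" using a by (simp add: field_simps)
    have "integral {0..q} (\<lambda>x. sin x ^ m) * exp ((c - \<eta>) * d) \<le> (q * sin q ^ m) * exp ((c - \<eta>) * d)"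
      using q by (intro mult_right_mono integral_sin_power_le) auto
    also have "\<dots> = sin q ^ m * (q * exp ((c - \<eta>) * d))" by simp
    also have "\<dots> \<le> sin q ^ m * ((\<theta> - a) * exp (L * m))" using sq e by (intro mult_left_mono) auto
    also have "\<dots> = (\<theta> - a) * sin a ^ m" by (simp add: pw)
    also have "\<dots> \<le> integral {0..\<theta>} (\<lambda>x. sin x ^ m)" using q a by (intro integral_sin_power_ge) auto
    finally have "G * (integral {0..q} (\<lambda>x. sin x ^ m) * exp ((c - \<eta>) * d)) \<le> G * integral {0..\<theta>} (\<lambda>x. sin x ^ m)"
      using G by (rule mult_left_mono)
    thus ?case using q elim cap_area_eq[of q d] cap_area_eq[of \<theta> d] by (simp add: m_def G_def mult.assoc)
  qed
  thus ?thesis by (simp add: c_def)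
qed

section \<open>Codes among random points\<close>

lemma id_sphere_measurable: "(\<lambda>x. x) \<in> measurable (sphere_measure d) (Rd d)"
  using measurable_restrict_space1[of "\<lambda>x. x" "Rd d" "Rd d" "unit_sphere d"]
  by (simp cong: measurable_cong_sets add: sets_sphere_measure)

lemma point_measurable:
  assumes "i \<in> D"
  shows "(\<lambda>x. x i) \<in> measurable (Pi\<^sub>M D (\<lambda>_. sphere_measure d)) (Rd d)"
  using measurable_compose[OF measurable_component_singleton[OF assms] id_sphere_measurable] by simp

lemma spherical_cap_sphere_sets:
  assumes "x \<in> unit_sphere d"
  shows "spherical_cap d x \<phi> \<in> sets (sphere_measure d)"
proof -
  have "spherical_cap d x \<phi> \<in> sets (Rd d)"
    using assms by (intro spherical_cap_sets) (auto simp: unit_sphere_def)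
  moreover have "spherical_cap d x \<phi> \<subseteq> unit_sphere d" by (auto simp: spherical_cap_def)
  ultimately show ?thesis
    by (simp add: sets_sphere_measure sets_restrict_space_iff)
qed

lemma measure_subset_cap_le:
  assumes d: "d \<ge> 2" and z: "z \<in> unit_sphere d" and A: "A \<subseteq> spherical_cap d z \<phi>"
  shows "measure (sphere_measure d) A \<le> cap_area d \<phi>"
proof -
  interpret prob_space "sphere_measure d" using d by (intro prob_space_sphere_measure) simp
  have "prob A \<le> prob (spherical_cap d z \<phi>)"
    by (intro finite_measure_mono A spherical_cap_sphere_sets z)
  thus ?thesis using cap_measure[OF d z] by simp
qed

lemma degree_tail:
  fixes t :: real
  assumes d: "d \<ge> 2" and i: "i < N" and t: "t \<ge> 0"
  shows "{x \<in> space (random_points d N). m \<le> card {k\<in>{..<N} - {i}. cos \<theta> < inner_d d (x i) (x k)}}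
           \<in> sets (random_points d N)"
    and "measure (random_points d N)
           {x \<in> space (random_points d N). m \<le> card {k\<in>{..<N} - {i}. cos \<theta> < inner_d d (x i) (x k)}}
           \<le> exp (t * cap_area d \<theta> * N) / (1 + t) ^ m"
proof -
  let ?M = "sphere_measure d" and ?J = "{..<N} - {i}"
  define R where "R u y \<longleftrightarrow> cos \<theta> < inner_d d (u i) y" for u y
  have M: "prob_space ?M" using d by (intro prob_space_sphere_measure) simp
  have 1: "(\<lambda>p. fst p i) \<in> measurable (Pi\<^sub>M {i} (\<lambda>_. ?M) \<Otimes>\<^sub>M ?M) (Rd d)"
    by (intro measurable_compose[OF measurable_fst point_measurable]) simp
  have 2: "(\<lambda>p. snd p) \<in> measurable (Pi\<^sub>M {i} (\<lambda>_. ?M) \<Otimes>\<^sub>M ?M) (Rd d)"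
    by (intro measurable_compose[OF measurable_snd id_sphere_measurable])
  have mR: "Measurable.pred (Pi\<^sub>M {i} (\<lambda>_. ?M) \<Otimes>\<^sub>M ?M) (\<lambda>(u, y). R u y)"
    unfolding case_prod_beta R_def using inner_d_measurable[OF 1 2] by measurable
  have p: "measure ?M {y \<in> space ?M. R u y} \<le> cap_area d \<theta>" if "u \<in> space (Pi\<^sub>M {i} (\<lambda>_. ?M))" for u
    using that d by (intro measure_subset_cap_le[of d "u i"]) (auto simp: space_PiM spherical_cap_def R_def)
  have p': "\<forall>u\<in>space (Pi\<^sub>M {i} (\<lambda>_. ?M)). measure ?M {y \<in> space ?M. R u y} \<le> cap_area d \<theta>"
    using p by blast
  have fin: "finite {i}" "finite ?J" and disj: "{i} \<inter> ?J = {}" by auto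
  have U: "{i} \<union> ?J = {..<N}" using i by auto
  have nb: "{k\<in>?J. cos \<theta> < inner_d d (x i) (x k)} = {k\<in>?J. R (restrict x {i}) (x k)}" for x
    by (simp add: R_def)
  note tail = binomial_tail[OF M fin disj mR p' t, of m, unfolded U, folded random_points_def nb]
  show "{x \<in> space (random_points d N). m \<le> card {k\<in>?J. cos \<theta> < inner_d d (x i) (x k)}}
      \<in> sets (random_points d N)" by (rule tail(1))
  have "exp (t * cap_area d \<theta> * card ?J) / (1 + t) ^ m \<le> exp (t * cap_area d \<theta> * N) / (1 + t) ^ m"
    using t i by (intro divide_right_mono) (auto simp: cap_area_def intro!: mult_left_mono)
  thus "measure (random_points d N)
      {x \<in> space (random_points d N). m \<le> card {k\<in>?J. cos \<theta> < inner_d d (x i) (x k)}}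
      \<le> exp (t * cap_area d \<theta> * N) / (1 + t) ^ m" using tail(2) by linarith
qed

text \<open>
  The points that conflict with \<open>x j\<close> and are at least as close to \<open>x i\<close> as \<open>x j\<close> is. The set is empty
  unless \<open>x i\<close> and \<open>x j\<close> are themselves in conflict: only then does the lens fit into a cap of radius
  \<open>cap_q \<theta>\<close>.
\<close>

definition lens :: "nat \<Rightarrow> real \<Rightarrow> nat \<Rightarrow> (nat \<Rightarrow> nat \<Rightarrow> real) \<Rightarrow> nat \<Rightarrow> nat \<Rightarrow> nat set" where
  "lens d \<theta> N x i j = {k\<in>{..<N} - {i, j}. cos \<theta> < inner_d d (x i) (x j) \<and>
     cos \<theta> < inner_d d (x j) (x k) \<and> inner_d d (x i) (x j) \<le> inner_d d (x i) (x k)}"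

lemma lens_tail:
  fixes t :: real
  assumes d: "d \<ge> 2" and \<theta>: "0 < \<theta>" "\<theta> < pi / 2" and ij: "i < N" "j < N" and t: "t \<ge> 0"
  shows "{x \<in> space (random_points d N). m \<le> card (lens d \<theta> N x i j)} \<in> sets (random_points d N)"
    and "measure (random_points d N) {x \<in> space (random_points d N). m \<le> card (lens d \<theta> N x i j)}
           \<le> exp (t * cap_area d (cap_q \<theta>) * N) / (1 + t) ^ m"
proof -
  let ?M = "sphere_measure d" and ?D = "{i, j}" and ?J = "{..<N} - {i, j}"
  define R where "R u y \<longleftrightarrow> cos \<theta> < inner_d d (u i) (u j) \<and> cos \<theta> < inner_d d (u j) y \<and>
      inner_d d (u i) (u j) \<le> inner_d d (u i) y" for u y
  have M: "prob_space ?M" using d by (intro prob_space_sphere_measure) simp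
  have 1: "(\<lambda>p. fst p k) \<in> measurable (Pi\<^sub>M ?D (\<lambda>_. ?M) \<Otimes>\<^sub>M ?M) (Rd d)" if "k \<in> ?D" for k
    using that by (intro measurable_compose[OF measurable_fst point_measurable]) simp
  have 2: "(\<lambda>p. snd p) \<in> measurable (Pi\<^sub>M ?D (\<lambda>_. ?M) \<Otimes>\<^sub>M ?M) (Rd d)"
    by (intro measurable_compose[OF measurable_snd id_sphere_measurable])
  have [measurable]: "(\<lambda>p. inner_d d (fst p i) (fst p j)) \<in> borel_measurable (Pi\<^sub>M ?D (\<lambda>_. ?M) \<Otimes>\<^sub>M ?M)"
     "(\<lambda>p. inner_d d (fst p j) (snd p)) \<in> borel_measurable (Pi\<^sub>M ?D (\<lambda>_. ?M) \<Otimes>\<^sub>M ?M)"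
     "(\<lambda>p. inner_d d (fst p i) (snd p)) \<in> borel_measurable (Pi\<^sub>M ?D (\<lambda>_. ?M) \<Otimes>\<^sub>M ?M)"
    by (intro inner_d_measurable 1 2; simp)+
  have mR: "Measurable.pred (Pi\<^sub>M ?D (\<lambda>_. ?M) \<Otimes>\<^sub>M ?M) (\<lambda>(u, y). R u y)"
    unfolding case_prod_beta R_def by measurable
  have p: "measure ?M {y \<in> space ?M. R u y} \<le> cap_area d (cap_q \<theta>)"
    if u: "u \<in> space (Pi\<^sub>M ?D (\<lambda>_. ?M))" for u
  proof (cases "cos \<theta> < inner_d d (u i) (u j)")
    case True
    have us: "u i \<in> unit_sphere d" "u j \<in> unit_sphere d" using u by (auto simp: space_PiM)
    from lens_subset_cap[OF \<theta> us] True obtain z where z: "z \<in> unit_sphere d"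
      "{w \<in> unit_sphere d. cos \<theta> \<le> inner_d d (u j) w \<and> inner_d d (u i) (u j) \<le> inner_d d (u i) w}
         \<subseteq> spherical_cap d z (cap_q \<theta>)" by auto
    show ?thesis by (rule measure_subset_cap_le[OF d z(1)]) (use z(2) in \<open>auto simp: R_def\<close>)
  next
    case False
    have "measure ?M {} \<le> cap_area d (cap_q \<theta>)" by (simp add: cap_area_def)
    thus ?thesis using False by (simp add: R_def)
  qed
  have p': "\<forall>u\<in>space (Pi\<^sub>M ?D (\<lambda>_. ?M)). measure ?M {y \<in> space ?M. R u y} \<le> cap_area d (cap_q \<theta>)"
    using p by blast
  have fin: "finite ?D" "finite ?J" and disj: "?D \<inter> ?J = {}" by auto
  have U: "?D \<union> ?J = {..<N}" using ij by auto
  have lens: "lens d \<theta> N x i j = {k\<in>?J. R (restrict x ?D) (x k)}" for x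
    by (simp add: lens_def R_def)
  note tail = binomial_tail[OF M fin disj mR p' t, of m, unfolded U, folded random_points_def lens]
  show "{x \<in> space (random_points d N). m \<le> card (lens d \<theta> N x i j)} \<in> sets (random_points d N)"
    by (rule tail(1))
  have "card ?J \<le> N" using card_mono[of "{..<N}" ?J] by auto
  hence "exp (t * cap_area d (cap_q \<theta>) * card ?J) / (1 + t) ^ m \<le> exp (t * cap_area d (cap_q \<theta>) * N) / (1 + t) ^ m"
    using t by (intro divide_right_mono) (auto simp: cap_area_def intro!: mult_left_mono)
  thus "measure (random_points d N) {x \<in> space (random_points d N). m \<le> card (lens d \<theta> N x i j)}
           \<le> exp (t * cap_area d (cap_q \<theta>) * N) / (1 + t) ^ m" using tail(2) by linarith
qed

text \<open>
  The points with indices in \<open>S\<close>, renumbered, are distributed like \<open>n\<close> random points.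
\<close>

lemma subset_code_prob:
  assumes d: "d \<ge> 1" and S: "S \<subseteq> {..<N}" "card S = n"
  shows "{x \<in> space (random_points d N). \<forall>i\<in>S. \<forall>j\<in>S. i \<noteq> j \<longrightarrow> inner_d d (x i) (x j) \<le> cos \<theta>}
           \<in> sets (random_points d N)" (is "?A \<in> _")
    and "measure (random_points d N)
       {x \<in> space (random_points d N). \<forall>i\<in>S. \<forall>j\<in>S. i \<noteq> j \<longrightarrow> inner_d d (x i) (x j) \<le> cos \<theta>}
       = code_prob d \<theta> n"
proof -
  have "finite S" using S finite_subset by blast
  then obtain f where f: "bij_betw f {..<n} S"
    using ex_bij_betw_nat_finite[of S] S by (auto simp: atLeast0LessThan)
  have inj: "inj_on f {..<n}" and im: "f ` {..<n} = S" using f by (auto simp: bij_betw_def)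
  have fN: "f \<in> {..<n} \<rightarrow> {..<N}" using im S by auto
  let ?t = "\<lambda>\<omega> :: nat \<Rightarrow> nat \<Rightarrow> real. \<lambda>k\<in>{..<n}. \<omega> (f k)"
  have D: "distr (random_points d N) (random_points d n) ?t = random_points d n"
    unfolding random_points_def using prob_space_sphere_measure[OF d]
    by (intro distr_PiM_reindex inj fN)
  have tm: "?t \<in> measurable (random_points d N) (random_points d n)"
    unfolding random_points_def using fN
    by (intro measurable_restrict measurable_component_singleton) auto
  have eq: "?A = ?t -` code_event d \<theta> n \<inter> space (random_points d N)"
  proof (intro set_eqI)
    fix x
    show "x \<in> ?A \<longleftrightarrow> x \<in> ?t -` code_event d \<theta> n \<inter> space (random_points d N)"
    proof (cases "x \<in> space (random_points d N)")
      case True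
      have xs: "x k \<in> unit_sphere d" if "k < N" for k
        using True that by (auto simp: random_points_def space_PiM)
      have "?t x \<in> space (random_points d n)" using measurable_space[OF tm True] .
      moreover have "f i \<noteq> f j \<longleftrightarrow> i \<noteq> j" if "i < n" "j < n" for i j
        using inj that by (auto simp: inj_on_eq_iff)
      ultimately show ?thesis using True xs fN
        by (auto simp: code_event_def spherical_code_def im[symmetric])
    qed auto
  qed
  show "?A \<in> sets (random_points d N)" unfolding eq using tm code_event_sets by (rule measurable_sets)
  have "measure (random_points d N) ?A = measure (distr (random_points d N) (random_points d n) ?t) (code_event d \<theta> n)"
    unfolding eq by (intro measure_distr[symmetric] tm code_event_sets)
  thus "measure (random_points d N) ?A = code_prob d \<theta> n" unfolding D code_prob_def .
qed

text \<open>
  The conflict graph joins \<open>i\<close> and \<open>j\<close> when \<open>x i\<close> and \<open>x j\<close> are at an angle less than \<open>\<theta>\<close>, so its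
  independent sets are the codes. Ranking the neighbours of \<open>v\<close> by their distance from \<open>x v\<close> makes the
  lens condition the sparseness that the hard-core bound needs.
\<close>

lemma sparse_points_contain_code:
  fixes z u0 :: real and m K n N :: nat
  assumes deg: "\<And>i. i < N \<Longrightarrow> card {k\<in>{..<N} - {i}. cos \<theta> < inner_d d (x i) (x k)} \<le> m"
    and lens: "\<And>i j. i < N \<Longrightarrow> j < N \<Longrightarrow> card (lens d \<theta> N x i j) \<le> K"
    and z: "0 < z" "z * (2 * real K + 1) \<le> 1" and u0: "u0 > 0"
    and n: "(real n - 1) * (m + (1 - z * (2 * real K + 1)) * (1 + z) / (z * u0)) <
       (1 - z * (2 * real K + 1)) * N * (ln (1 / u0) + 1)"
  shows "\<exists>S\<subseteq>{..<N}. card S = n \<and> (\<forall>i\<in>S. \<forall>j\<in>S. i \<noteq> j \<longrightarrow> inner_d d (x i) (x j) \<le> cos \<theta>)"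
proof -
  define E where "E i j \<longleftrightarrow> i \<noteq> j \<and> cos \<theta> < inner_d d (x i) (x j)" for i j
  interpret hard_core E z
    by standard (use z in \<open>auto simp: E_def inner_d_commute\<close>)
  let ?V = "{..<N}" and ?Q = "m + (1 - z * (2 * real K + 1)) * (1 + z) / (z * u0)"
  have nb: "?V \<inter> nbrs {v} = {k\<in>?V - {v}. cos \<theta> < inner_d d (x v) (x k)}" for v
    by (auto simp: nbrs_def E_def)
  have "\<exists>I\<in>Ind ?V. (1 - z * (2 * real K + 1)) * card ?V * (ln (1 / u0) + 1) \<le> card I * ?Q"
  proof (rule large_independent_set[OF _ z(2) u0])
    fix v assume "v \<in> ?V"
    thus "card (?V \<inter> nbrs {v}) \<le> m" unfolding nb using deg by simp
  next
    fix v T assume v: "v \<in> ?V" and T: "T \<subseteq> ?V \<inter> nbrs {v}"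
    hence fT: "finite T" using finite_subset by blast
    show "(\<Sum>u\<in>T. card (T \<inter> nbrs {u})) \<le> 2 * K * card T"
    proof (rule sum_degrees_le_of_rank[OF fT, of "\<lambda>w. inner_d d (x v) (x w)"])
      fix u assume u: "u \<in> T"
      have "{w\<in>T. E u w \<and> inner_d d (x v) (x u) \<le> inner_d d (x v) (x w)} \<subseteq> lens d \<theta> N x v u"
        using T u unfolding lens_def nb by (auto simp: E_def)
      hence "card {w\<in>T. E u w \<and> inner_d d (x v) (x u) \<le> inner_d d (x v) (x w)} \<le> card (lens d \<theta> N x v u)"
        by (intro card_mono) (auto simp: lens_def)
      also have "\<dots> \<le> K" using v u T by (intro lens) auto
      finally show "card {w\<in>T. E u w \<and> inner_d d (x v) (x u) \<le> inner_d d (x v) (x w)} \<le> K" .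
    qed
  qed simp
  then obtain I where I: "I \<in> Ind ?V"
    "(1 - z * (2 * real K + 1)) * N * (ln (1 / u0) + 1) \<le> card I * ?Q" by auto
  have "?Q \<ge> 0" using z u0 by auto
  moreover have "(real n - 1) * ?Q < card I * ?Q" using n I(2) by linarith
  ultimately have "real n - 1 < card I" by (metis mult_right_mono not_le)
  hence "n \<le> card I" by linarith
  then obtain S where S: "S \<subseteq> I" "card S = n" using obtain_subset_with_card_n by metis
  have "\<forall>i\<in>S. \<forall>j\<in>S. \<not> E i j" using IndD(2)[OF I(1)] S by (auto simp: indep_def)
  thus ?thesis using S IndD(1)[OF I(1)] by (intro exI[of _ S]) (auto simp: E_def not_less)
qed

text \<open>
  If neither of the two bad events has probability more than \<open>1 / 4\<close>, then with probability at least
  \<open>1 / 2\<close> some \<open>n\<close> of the \<open>N\<close> points form a code; a union bound over the choice of these points turns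
  this into a bound on \<open>code_prob\<close>.
\<close>

lemma code_prob_lower:
  fixes z u0 t t' :: real and m K n N :: nat
  assumes d: "d \<ge> 2" and \<theta>: "0 < \<theta>" "\<theta> < pi / 2" and t: "t \<ge> 0" "t' \<ge> 0"
    and deg: "N * (exp (t * cap_area d \<theta> * N) / (1 + t) ^ m) \<le> 1 / 4"
    and lens: "N\<^sup>2 * (exp (t' * cap_area d (cap_q \<theta>) * N) / (1 + t') ^ K) \<le> 1 / 4"
    and z: "0 < z" "z * (2 * real K + 1) \<le> 1" and u0: "u0 > 0"
    and n: "(real n - 1) * (m + (1 - z * (2 * real K + 1)) * (1 + z) / (z * u0)) <
       (1 - z * (2 * real K + 1)) * N * (ln (1 / u0) + 1)"
  shows "1 / 2 \<le> (N choose n) * code_prob d \<theta> n"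
proof -
  interpret P: prob_space "random_points d N" using d by (intro prob_space_random_points) simp
  let ?\<Omega> = "space (random_points d N)"
  let ?B = "\<lambda>i. {x \<in> ?\<Omega>. m \<le> card {k\<in>{..<N} - {i}. cos \<theta> < inner_d d (x i) (x k)}}"
  let ?L = "\<lambda>p. {x \<in> ?\<Omega>. K \<le> card (lens d \<theta> N x (fst p) (snd p))}"
  let ?A = "\<lambda>S. {x \<in> ?\<Omega>. \<forall>i\<in>S. \<forall>j\<in>S. i \<noteq> j \<longrightarrow> inner_d d (x i) (x j) \<le> cos \<theta>}"
  let ?F = "{S. S \<subseteq> {..<N} \<and> card S = n}"
  let ?N2 = "{..<N} \<times> {..<N}"
  have finF: "finite ?F" by (rule finite_subset[of _ "Pow {..<N}"]) auto
  have Bm: "?B ` {..<N} \<subseteq> P.events" by (rule image_subsetI, rule degree_tail(1)[OF d _ t(1)]) simp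
  have Lm: "?L ` ?N2 \<subseteq> P.events" by (rule image_subsetI, rule lens_tail(1)[OF d \<theta> _ _ t(2)]) auto
  have Am: "?A ` ?F \<subseteq> P.events" by (rule image_subsetI, rule subset_code_prob(1)) (use d in auto)
  \<comment> \<open>some degree is large, some lens is crowded, some \<open>n\<close> points form a code\<close>
  define BB where "BB = (\<Union>i\<in>{..<N}. ?B i)"
  define LL where "LL = (\<Union>p\<in>?N2. ?L p)"
  define AA where "AA = (\<Union>S\<in>?F. ?A S)"
  have ev: "BB \<in> P.events" "LL \<in> P.events" "AA \<in> P.events"
    unfolding BB_def LL_def AA_def
    by (rule sets.finite_Union[OF finite_imageI Bm] sets.finite_Union[OF finite_imageI Lm]
        sets.finite_Union[OF finite_imageI[OF finF] Am]; simp?)+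
  have cover: "?\<Omega> \<subseteq> (BB \<union> LL) \<union> AA"
  proof
    fix x assume x: "x \<in> ?\<Omega>"
    show "x \<in> (BB \<union> LL) \<union> AA"
    proof (cases "x \<in> BB \<union> LL")
      case False
      have 1: "card {k\<in>{..<N} - {i}. cos \<theta> < inner_d d (x i) (x k)} \<le> m" if "i < N" for i
      proof -
        have "x \<notin> ?B i" using False that unfolding BB_def by blast
        thus ?thesis using x by simp
      qed
      have 2: "card (lens d \<theta> N x i j) \<le> K" if "i < N" "j < N" for i j
      proof -
        have "(i, j) \<in> ?N2" using that by simp
        hence "x \<notin> ?L (i, j)" using False unfolding LL_def by blast
        thus ?thesis using x by simp
      qed
      obtain S where "S \<subseteq> {..<N}" "card S = n"
        "\<forall>i\<in>S. \<forall>j\<in>S. i \<noteq> j \<longrightarrow> inner_d d (x i) (x j) \<le> cos \<theta>"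
        using sparse_points_contain_code[OF 1 2 z u0 n] by blast
      hence "x \<in> AA" using x unfolding AA_def by blast
      thus ?thesis by blast
    qed blast
  qed
  have "P.prob BB \<le> (\<Sum>i<N. P.prob (?B i))"
    unfolding BB_def by (rule P.finite_measure_subadditive_finite[OF _ Bm]) simp
  also have "\<dots> \<le> (\<Sum>i<N. exp (t * cap_area d \<theta> * N) / (1 + t) ^ m)"
    by (intro sum_mono degree_tail(2) d t) simp
  also have "\<dots> = N * (exp (t * cap_area d \<theta> * N) / (1 + t) ^ m)" by simp
  also note deg
  finally have 1: "P.prob BB \<le> 1 / 4" .
  have "P.prob LL \<le> (\<Sum>p\<in>?N2. P.prob (?L p))"
    unfolding LL_def by (rule P.finite_measure_subadditive_finite[OF _ Lm]) simp
  also have "\<dots> \<le> (\<Sum>p\<in>?N2. exp (t' * cap_area d (cap_q \<theta>) * N) / (1 + t') ^ K)"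
    by (rule sum_mono, rule lens_tail(2)[OF d \<theta> _ _ t(2)]) auto
  also have "\<dots> = N\<^sup>2 * (exp (t' * cap_area d (cap_q \<theta>) * N) / (1 + t') ^ K)"
    by (simp add: card_cartesian_product power2_eq_square)
  also note lens
  finally have 2: "P.prob LL \<le> 1 / 4" .
  have "P.prob AA \<le> (\<Sum>S\<in>?F. P.prob (?A S))"
    unfolding AA_def by (intro P.finite_measure_subadditive_finite finF Am)
  also have "\<dots> = (\<Sum>S\<in>?F. code_prob d \<theta> n)"
    using d by (intro sum.cong refl subset_code_prob(2)) auto
  also have "\<dots> = (N choose n) * code_prob d \<theta> n" by (simp add: n_subsets)
  finally have 3: "P.prob AA \<le> (N choose n) * code_prob d \<theta> n" .
  have "1 \<le> P.prob ((BB \<union> LL) \<union> AA)"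
    using P.finite_measure_mono[OF cover sets.Un[OF sets.Un[OF ev(1,2)] ev(3)]]
    unfolding P.prob_space .
  also have "\<dots> \<le> P.prob (BB \<union> LL) + P.prob AA"
    by (intro measure_Un_le sets.Un ev)
  also have "P.prob (BB \<union> LL) \<le> P.prob BB + P.prob LL" by (intro measure_Un_le ev)
  finally show ?thesis using 1 2 3 by linarith
qed

section \<open>The choice of parameters\<close>

text \<open>
  The factor on the right is what remains of \<open>c\<close> after all losses in the choice of parameters below.
\<close>

lemma rate_loss_small:
  fixes c \<epsilon> :: real
  assumes "c > 0" "\<epsilon> > 0"
  shows "\<exists>\<eta>. 0 < \<eta> \<and> \<eta> < 1 \<and> 3 * \<eta> < c \<and> (1 - \<epsilon>) * c \<le> (1 - \<eta>) * (c - 3 * \<eta>) / (1 + 2 * \<eta>)\<^sup>2"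
proof -
  have "((\<lambda>\<eta>. (1 - \<eta>) * (c - 3 * \<eta>) / (1 + 2 * \<eta>)\<^sup>2) \<longlongrightarrow> (1 - 0) * (c - 3 * 0) / (1 + 2 * 0)\<^sup>2) (at_right (0::real))"
    by (intro tendsto_intros) auto
  moreover have "(1 - \<epsilon>) * c < (1 - 0) * (c - 3 * 0) / (1 + 2 * 0)\<^sup>2" using assms by (simp add: algebra_simps)
  ultimately have "\<forall>\<^sub>F \<eta> in at_right (0::real). (1 - \<epsilon>) * c < (1 - \<eta>) * (c - 3 * \<eta>) / (1 + 2 * \<eta>)\<^sup>2"
    by (rule order_tendstoD)
  moreover have "\<forall>\<^sub>F \<eta> in at_right (0::real). \<eta> \<in> {0<..<min 1 (c / 3)}"
    using assms by (intro eventually_at_right_real) auto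
  ultimately have "\<forall>\<^sub>F \<eta> in at_right (0::real). 0 < \<eta> \<and> \<eta> < 1 \<and> 3 * \<eta> < c \<and>
      (1 - \<epsilon>) * c \<le> (1 - \<eta>) * (c - 3 * \<eta>) / (1 + 2 * \<eta>)\<^sup>2"
    by eventually_elim auto
  thus ?thesis using eventually_happens[of _ "at_right (0::real)"] by force
qed

lemma chernoff_exponent_pos:
  fixes \<eta> :: real
  assumes "\<eta> > 0"
  shows "(1 + \<eta>) * ln (1 + \<eta>) - \<eta> > 0"
proof -
  have "ln (1 / (1 + \<eta>)) \<le> 1 / (1 + \<eta>) - 1" using assms by (intro ln_le_minus_one) auto
  moreover have "ln (1 / (1 + \<eta>)) \<noteq> 1 / (1 + \<eta>) - 1"
    using ln_eq_minus_one[of "1 / (1 + \<eta>)"] assms by auto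
  ultimately have "- ln (1 + \<eta>) < 1 / (1 + \<eta>) - 1" using assms by (simp add: ln_div)
  hence "(1 + \<eta>) * - ln (1 + \<eta>) < (1 + \<eta>) * (1 / (1 + \<eta>) - 1)"
    using assms by (intro mult_strict_left_mono) auto
  thus ?thesis using assms by (simp add: right_diff_distrib)
qed

text \<open>
  The parameters, for a small \<open>\<eta> > 0\<close> that does not depend on \<open>d\<close>. With \<open>N\<close> about
  \<open>exp (- \<eta> d) / cap_area d (cap_q \<theta>)\<close> points, a lens contains at most \<open>exp (- \<eta> d)\<close> points on
  average, so the probability of \<open>K\<close> points in a given lens is about \<open>exp (- \<eta> d K)\<close>. There are only
  exponentially many lenses, so a constant \<open>K\<close> suffices, and with it a constant fugacity \<open>z\<close>. The
  degrees are concentrated around their mean \<open>\<mu>\<close>, which is at least about \<open>exp ((c - 2 * \<eta>) * d)\<close>.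
  The hard-core bound then gives a code of size about \<open>N * ln \<mu> / \<mu>\<close>, and this is about
  \<open>c * d / cap_area d \<theta>\<close>, since \<open>\<mu> = N * cap_area d \<theta>\<close>.
\<close>

lemma eventually_code_size:
  fixes \<theta> \<epsilon> :: real
  assumes \<theta>: "0 < \<theta>" "\<theta> < pi / 2" and \<epsilon>: "\<epsilon> > 0"
  shows "\<forall>\<^sub>F d in sequentially. \<exists>n>0. (1 - \<epsilon>) * (cap_c \<theta> * real d / cap_area d \<theta>) \<le> real n \<and>
    0 < code_prob d \<theta> n \<and> 0 < cap_area d (cap_q \<theta>) \<and>
    cap_area d (cap_q \<theta>) ^ n \<le> code_prob d \<theta> n / fact n"
proof -
  define c where "c = cap_c \<theta>"
  note q\<theta> = cos_cap_q(2,3)[OF \<theta>]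
  have "sin (cap_q \<theta>) < sin \<theta>" using q\<theta> \<theta> by (intro sin_monotone_2pi) auto
  moreover have "0 < sin (cap_q \<theta>)" using q\<theta> \<theta> by (intro sin_gt_zero) auto
  ultimately have c: "c > 0" by (simp add: c_def cap_c_def)
  obtain \<eta> where \<eta>: "0 < \<eta>" "\<eta> < 1" "3 * \<eta> < c"
    "(1 - \<epsilon>) * c \<le> (1 - \<eta>) * (c - 3 * \<eta>) / (1 + 2 * \<eta>)\<^sup>2"
    using rate_loss_small[OF c \<epsilon>] by blast
  have "cap_q \<theta> < pi / 2" using q\<theta> \<theta> by linarith
  then obtain C where C: "C > 0" "\<forall>\<^sub>F d in sequentially. exp (- C * real d) \<le> cap_area d (cap_q \<theta>)"
    using cap_area_lower[OF q\<theta>(1)] by blast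
  have ratio: "\<forall>\<^sub>F d in sequentially. cap_area d (cap_q \<theta>) * exp ((c - \<eta>) * real d) \<le> cap_area d \<theta>"
    using cap_area_ratio[OF q\<theta> \<theta>(2) \<eta>(1)] by (simp add: c_def cap_c_def)
  \<comment> \<open>\<open>exp (- \<eta> d K)\<close> must beat the number \<open>N\<^sup>2 \<le> exp (2 * C * d)\<close> of lenses\<close>
  define K where "K = nat \<lceil>(2 * C + 1) / \<eta>\<rceil>"
  have "(2 * C + 1) / \<eta> \<le> K" unfolding K_def by linarith
  hence K: "2 * C + 1 \<le> \<eta> * K" using \<eta> by (simp add: divide_le_eq mult.commute)
  \<comment> \<open>makes the factor \<open>1 - z * (2 * K + 1)\<close> of the hard-core bound equal to \<open>1 - \<eta>\<close>\<close>
  define z where "z = \<eta> / (2 * real K + 1)"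
  have z: "0 < z" "z \<le> 1" "z * (2 * real K + 1) = \<eta>" using \<eta> by (auto simp: z_def divide_le_eq)
  \<comment> \<open>the Chernoff exponent, per unit of the mean, of exceeding the mean by the factor \<open>1 + \<eta>\<close>\<close>
  define h where "h = (1 + \<eta>) * ln (1 + \<eta>) - \<eta>"
  have h: "h > 0" unfolding h_def by (rule chernoff_exponent_pos) fact
  define g where "g = c - 2 * \<eta>"
  have g: "g > 0" using \<eta> by (simp add: g_def)
  have E4: "\<forall>\<^sub>F d :: nat in sequentially. exp (g * d) \<ge> 2" using g by real_asymp
  have E5: "\<forall>\<^sub>F d :: nat in sequentially. \<eta> * (exp (g * d) / 2) \<ge> 1" using g \<eta>(1) by real_asymp
  have E6: "\<forall>\<^sub>F d :: nat in sequentially. exp (C * d - h * (exp (g * d) / 2)) \<le> 1 / 4" 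
    using g h C(1) by real_asymp
  have E7: "\<forall>\<^sub>F d :: nat in sequentially. exp (1 - real d) \<le> 1 / 4" by real_asymp
  have E8: "\<forall>\<^sub>F d :: nat in sequentially. - ln (z * \<eta> / 2) \<le> \<eta> * d" using \<eta>(1) by real_asymp
  have E9: "\<forall>\<^sub>F d :: nat in sequentially. exp (- \<eta> * d) \<le> 1 / 2" using \<eta>(1) by real_asymp
  show ?thesis
    using C(2) ratio E4 E5 E6 E7 E8 E9 eventually_ge_at_top[of 2]
  proof eventually_elim
    case (elim d)
    define s q where "s = cap_area d \<theta>" and "q = cap_area d (cap_q \<theta>)"
    note E = elim[folded s_def q_def]
    interpret sp: prob_space "sphere_measure d" using E(9) by (intro prob_space_sphere_measure) simp
    have q: "q > 0" using E(1) exp_gt_zero[of "- C * real d"] by linarith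
    have s1: "s \<le> 1" by (simp add: s_def cap_area_def)
    have "q * exp ((c - \<eta>) * d) > 0" using q by simp
    hence s: "s > 0" using E(2) by linarith
    define y where "y = exp (- \<eta> * d) / q"
    have split: "exp ((c - \<eta>) * d) = exp (g * d) * exp (\<eta> * d)" unfolding g_def exp_add[symmetric]
      by (simp add: algebra_simps)
    have inv: "exp (\<eta> * d) * exp (- \<eta> * d) = 1" by (simp flip: exp_add)
    have "q * exp (g * d) = q * exp ((c - \<eta>) * d) * exp (- \<eta> * d)" unfolding split
      using inv by (simp only: mult.assoc mult_1_right)
    also have "\<dots> \<le> 1 * exp (- \<eta> * d)" using E(2) s1 by (intro mult_right_mono) auto
    finally have yg: "exp (g * d) \<le> y" using q by (simp add: y_def le_divide_eq mult.commute)
    hence y2: "y \<ge> 2" using E(3) by linarith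
    define N where "N = nat \<lfloor>y\<rfloor>"
    have N: "y / 2 \<le> N" "N \<le> y" "1 \<le> N" unfolding N_def using y2 by linarith+
    have yq: "y * q = exp (- \<eta> * d)" using q by (simp add: y_def)
    have Nq: "N * q \<le> exp (- \<eta> * d)" using mult_right_mono[OF N(2), of q] q yq by simp
    have Nq2: "N * q \<le> 1 / 2" using Nq E(8) by linarith
    have "y \<le> 1 / q" unfolding y_def using q \<eta> by (intro divide_right_mono) auto
    also have "\<dots> \<le> 1 / exp (- C * d)" using E(1) q by (intro divide_left_mono) auto
    finally have NC: "N \<le> exp (C * d)" using N(2) by (simp add: exp_minus field_simps)
    define \<mu> where "\<mu> = N * s"
    have "exp (g * d) / 2 = (y / 2) * (q * exp ((c - \<eta>) * d))"
    proof -
      have "(y / 2) * (q * exp ((c - \<eta>) * d)) = (y * q) * exp (\<eta> * d) * exp (g * d) / 2"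
        unfolding split by simp
      also have "\<dots> = exp (g * d) / 2" unfolding yq using inv by (simp add: mult.commute)
      finally show ?thesis by simp
    qed
    also have "\<dots> \<le> N * s" using N E(2) q by (intro mult_mono) auto
    finally have \<mu>: "exp (g * d) / 2 \<le> \<mu>" by (simp add: \<mu>_def)
    hence \<mu>0: "\<mu> > 0" using exp_gt_zero[of "g * d"] by linarith
    have "\<eta> * (exp (g * d) / 2) \<le> \<eta> * \<mu>" using \<mu> \<eta> by (intro mult_left_mono) auto
    hence \<eta>\<mu>: "1 \<le> \<eta> * \<mu>" using E(4) by linarith
    define m where "m = nat \<lceil>(1 + \<eta>) * \<mu>\<rceil>"
    have "(1 + \<eta>) * \<mu> \<ge> 0" using \<eta> \<mu>0 by simp
    hence m: "(1 + \<eta>) * \<mu> \<le> m" "m \<le> (1 + \<eta>) * \<mu> + 1" unfolding m_def by linarith+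
    have m2: "m \<le> (1 + 2 * \<eta>) * \<mu>" using m(2) \<eta>\<mu> by (simp add: algebra_simps)
    have "\<mu> \<le> (1 + \<eta>) * \<mu>" using \<eta> \<mu>0 by simp
    hence m\<mu>: "\<mu> \<le> m" using m(1) by linarith
    hence m0: "m > 0" using \<mu>0 by linarith
    \<comment> \<open>larger than \<open>1 / (z * m)\<close> by the factor \<open>1 / \<eta>\<close>: the second summand of \<open>Q\<close> is then of order
      \<open>\<eta> * m\<close>, at the price of a constant in the logarithm\<close>
    define u0 where "u0 = 1 / (z * \<eta> * m)"
    have u0: "u0 > 0" using z \<eta> m0 by (simp add: u0_def)
    define Q where "Q = m + (1 - z * (2 * real K + 1)) * (1 + z) / (z * u0)"
    define X where "X = (1 - z * (2 * real K + 1)) * N * (ln (1 / u0) + 1)"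
    have "Q = m * (1 + (1 - \<eta>) * (1 + z) * \<eta>)"
      unfolding Q_def u0_def z(3) using z m0 \<eta> by (simp add: field_simps)
    also have "\<dots> \<le> m * (1 + 2 * \<eta>)"
    proof -
      have "(1 - \<eta>) * (1 + z) \<le> 1 * 2" using z \<eta> by (intro mult_mono) auto
      hence "(1 - \<eta>) * (1 + z) * \<eta> \<le> 2 * \<eta>" using \<eta> by (intro mult_right_mono) auto
      thus ?thesis by (intro mult_left_mono) auto
    qed
    also have "\<dots> \<le> ((1 + 2 * \<eta>) * \<mu>) * (1 + 2 * \<eta>)" using m2 \<eta> by (intro mult_right_mono) auto
    finally have Q: "Q \<le> (1 + 2 * \<eta>)\<^sup>2 * \<mu>" by (simp add: power2_eq_square algebra_simps)
    have "m \<le> Q" unfolding Q_def z(3) using z u0 \<eta> by simp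
    hence Q0: "Q > 0" using m0 by linarith
    have "ln (z * \<eta> / 2) + g * d = ln (z * \<eta> * (exp (g * d) / 2))"
      using z \<eta> by (simp add: ln_mult ln_div)
    also have "\<dots> \<le> ln (z * \<eta> * m)"
    proof (rule ln_mono)
      show "z * \<eta> * (exp (g * d) / 2) \<le> z * \<eta> * m" using \<mu> m\<mu> z \<eta> by (intro mult_left_mono) auto
    qed (use z \<eta> in auto)
    also have "z * \<eta> * m = 1 / u0" by (simp add: u0_def)
    finally have "(c - 3 * \<eta>) * d \<le> ln (1 / u0)" using E(7) by (simp add: g_def algebra_simps)
    hence "(1 - \<eta>) * N * ((c - 3 * \<eta>) * d) \<le> (1 - \<eta>) * N * (ln (1 / u0) + 1)"
      using \<eta> by (intro mult_left_mono) auto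
    hence X: "(1 - \<eta>) * N * ((c - 3 * \<eta>) * d) \<le> X" by (simp add: X_def z(3))
    have dpos: "real d > 0" using E(9) by simp
    have "(1 - \<eta>) * N * ((c - 3 * \<eta>) * d) > 0" using \<eta> N(3) dpos by (intro mult_pos_pos) auto
    hence X0: "X > 0" using X by linarith
    have "(1 - \<epsilon>) * (c * d / s) = ((1 - \<epsilon>) * c) * (d / s)" by simp
    also have "\<dots> \<le> ((1 - \<eta>) * (c - 3 * \<eta>) / (1 + 2 * \<eta>)\<^sup>2) * (d / s)"
      using \<eta>(4) s by (intro mult_right_mono) auto
    also have "\<dots> = ((1 - \<eta>) * N * ((c - 3 * \<eta>) * d)) / ((1 + 2 * \<eta>)\<^sup>2 * \<mu>)"
      using N(3) by (simp add: \<mu>_def)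
    also have "\<dots> \<le> X / Q" using X X0 Q Q0 by (intro frac_le) auto
    finally have XQ: "(1 - \<epsilon>) * (c * d / s) \<le> X / Q" .
    define n where "n = nat \<lceil>X / Q\<rceil>"
    have XQ0: "X / Q > 0" using X0 Q0 by simp
    hence n: "X / Q \<le> n" "real n - 1 < X / Q" "n > 0" unfolding n_def by linarith+
    have "(real n - 1) * Q < X" using n(2) Q0 by (simp add: less_divide_eq)
    note size = this[unfolded Q_def X_def]
    have deg: "N * (exp (\<eta> * s * N) / (1 + \<eta>) ^ m) \<le> 1 / 4"
    proof -
      have "(1 + \<eta>) ^ m = exp (m * ln (1 + \<eta>))" using \<eta> by (simp add: exp_of_nat_mult)
      hence "N * (exp (\<eta> * s * N) / (1 + \<eta>) ^ m) = N * exp (\<eta> * \<mu> - m * ln (1 + \<eta>))"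
        by (simp add: exp_diff \<mu>_def mult_ac)
      also have "\<dots> \<le> exp (C * d) * exp (- (h * (exp (g * d) / 2)))"
      proof (intro mult_mono NC)
        have "(1 + \<eta>) * \<mu> * ln (1 + \<eta>) \<le> m * ln (1 + \<eta>)" using m \<eta> by (intro mult_right_mono) auto
        moreover have "h * (exp (g * d) / 2) \<le> h * \<mu>" using h \<mu> by (intro mult_left_mono) auto
        ultimately have "\<eta> * \<mu> - m * ln (1 + \<eta>) \<le> - (h * (exp (g * d) / 2))"
          by (simp add: h_def algebra_simps)
        thus "exp (\<eta> * \<mu> - m * ln (1 + \<eta>)) \<le> exp (- (h * (exp (g * d) / 2)))" by simp
      qed auto
      also have "\<dots> = exp (C * d - h * (exp (g * d) / 2))" by (simp flip: exp_add)
      finally show ?thesis using E(5) by linarith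
    qed
    \<comment> \<open>here the exponential moment is taken with the parameter \<open>t = exp (\<eta> * d)\<close>, the reciprocal of the
      bound on the mean number of points in a lens\<close>
    have lens: "N\<^sup>2 * (exp (exp (\<eta> * d) * q * N) / (1 + exp (\<eta> * d)) ^ K) \<le> 1 / 4"
    proof -
      have "exp (\<eta> * d) * (N * q) \<le> exp (\<eta> * d) * exp (- \<eta> * d)" using Nq by (intro mult_left_mono) auto
      hence "exp (\<eta> * d) * (N * q) \<le> 1" unfolding inv .
      moreover have "exp (\<eta> * d) * q * N = exp (\<eta> * d) * (N * q)" by simp
      ultimately have "exp (exp (\<eta> * d) * q * N) \<le> exp 1" by (simp only: exp_le_cancel_iff)
      moreover have "exp ((2 * C + 1) * d) \<le> (1 + exp (\<eta> * d)) ^ K"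
      proof -
        have "exp ((2 * C + 1) * d) \<le> exp (\<eta> * K * d)" using K by (simp add: mult_right_mono)
        also have "\<dots> = exp (\<eta> * d) ^ K" by (simp add: mult_ac flip: exp_of_nat_mult)
        also have "\<dots> \<le> (1 + exp (\<eta> * d)) ^ K" by (intro power_mono) auto
        finally show ?thesis .
      qed
      ultimately have "exp (exp (\<eta> * d) * q * N) / (1 + exp (\<eta> * d)) ^ K \<le> exp 1 / exp ((2 * C + 1) * d)"
        by (intro frac_le) auto
      moreover have "(real N)\<^sup>2 \<le> exp (C * d) ^ 2" using NC by (intro power_mono) auto
      ultimately have "N\<^sup>2 * (exp (exp (\<eta> * d) * q * N) / (1 + exp (\<eta> * d)) ^ K) \<le>
          exp (C * d) ^ 2 * (exp 1 / exp ((2 * C + 1) * d))"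
        unfolding of_nat_power by (intro mult_mono divide_nonneg_nonneg zero_le_power) auto
      also have "\<dots> = exp (1 - real d)"
        by (simp add: exp_diff[symmetric] exp_add[symmetric] power2_eq_square algebra_simps)
      finally show ?thesis using E(6) by linarith
    qed
    have half: "1 / 2 \<le> (N choose n) * code_prob d \<theta> n"
      using \<eta> z by (intro code_prob_lower[OF E(9) \<theta> _ _ deg[unfolded s_def] lens[unfolded q_def] z(1) _ u0 size]) auto
    have P0: "code_prob d \<theta> n \<ge> 0" by (simp add: code_prob_def)
    have Ppos: "code_prob d \<theta> n > 0"
    proof (rule ccontr)
      assume "\<not> ?thesis"
      hence "code_prob d \<theta> n = 0" using P0 by linarith
      thus False using half by simp
    qed
    have "real ((N choose n) * fact n) \<le> real (N ^ n)" by (intro of_nat_mono binomial_fact_pow)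
    hence "(N choose n) * fact n \<le> (real N) ^ n" by simp
    hence "(N choose n) \<le> (real N) ^ n / fact n" by (simp add: le_divide_eq)
    hence "(N choose n) * code_prob d \<theta> n \<le> (real N) ^ n / fact n * code_prob d \<theta> n"
      using P0 by (intro mult_right_mono) auto
    also have "\<dots> = (real N) ^ n * (code_prob d \<theta> n / fact n)" by simp
    finally have le: "1 / 2 \<le> (real N) ^ n * (code_prob d \<theta> n / fact n)" using half by linarith
    have "(N * q) ^ n \<le> (N * q) ^ 1" using Nq2 q n(3) by (intro power_decreasing) auto
    hence "(real N) ^ n * q ^ n \<le> 1 / 2" using Nq2 by (simp add: power_mult_distrib)
    hence "(real N) ^ n * q ^ n \<le> (real N) ^ n * (code_prob d \<theta> n / fact n)" using le by linarith
    moreover have "0 < (real N) ^ n" using N(3) by simp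
    ultimately have "q ^ n \<le> code_prob d \<theta> n / fact n" by (rule mult_left_le_imp_le)
    moreover have "(1 - \<epsilon>) * (c * d / s) \<le> n" using XQ n(1) by linarith
    ultimately show ?case using Ppos q n(3) unfolding s_def q_def c_def
      by (intro exI[of _ n] conjI)
  qed
qed

section \<open>The limit\<close>

text \<open>
  This turns a bound with an arbitrary fixed error into one with a vanishing error: \<open>\<kappa> d\<close> is the
  largest \<open>k \<le> d\<close> for which the bound already holds at \<open>d\<close>.
\<close>

lemma diagonal_sequence:
  fixes P :: "nat \<Rightarrow> nat \<Rightarrow> bool"
  assumes "\<And>k. \<forall>\<^sub>F d in sequentially. P k d"
  shows "\<exists>\<kappa>. filterlim \<kappa> at_top sequentially \<and> (\<forall>\<^sub>F d in sequentially. P (\<kappa> d) d)"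
proof -
  define A where "A d = {k. k \<le> d \<and> P k d}" for d
  have fin: "finite (A d)" for d unfolding A_def by simp
  have ev: "\<forall>\<^sub>F d in sequentially. k \<in> A d" for k
    using assms[of k] eventually_ge_at_top[of k] by eventually_elim (simp add: A_def)
  have "filterlim (\<lambda>d. Max (A d)) at_top sequentially"
    unfolding filterlim_at_top
  proof
    fix k show "\<forall>\<^sub>F d in sequentially. k \<le> Max (A d)"
      using ev[of k] by eventually_elim (rule Max_ge[OF fin])
  qed
  moreover have "\<forall>\<^sub>F d in sequentially. P (Max (A d)) d"
    using ev[of 0]
  proof eventually_elim
    case (elim d)
    hence "Max (A d) \<in> A d" using fin by (intro Max_in) auto
    thus ?case by (simp add: A_def)
  qed
  ultimately show ?thesis by blast
qed

theorem theorem3: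
  fixes \<theta> :: real
  assumes "0 < \<theta>" "\<theta> < pi / 2"
  shows "\<exists>(n :: nat \<Rightarrow> nat) (\<epsilon> :: nat \<Rightarrow> real) (\<delta> :: nat \<Rightarrow> real).
           (\<forall>d. n d > 0) \<and> \<epsilon> \<longlonglongrightarrow> 0 \<and> \<delta> \<longlonglongrightarrow> 0 \<and>
           (\<forall>\<^sub>F d in sequentially.
              real (n d) \<ge> (1 + \<epsilon> d) * (cap_c \<theta> * real d / cap_area d \<theta>) \<and>
              code_prob d \<theta> (n d) > 0 \<and>
              1 / real (n d) * ln (code_prob d \<theta> (n d) / fact (n d))
                \<ge> ln (cap_area d (cap_q \<theta>)) + \<delta> d)"
proof -
  define good where "good \<epsilon> d n \<longleftrightarrow> n > 0 \<and> (1 - \<epsilon>) * (cap_c \<theta> * real d / cap_area d \<theta>) \<le> real n \<and>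
    0 < code_prob d \<theta> n \<and> 0 < cap_area d (cap_q \<theta>) \<and>
    cap_area d (cap_q \<theta>) ^ n \<le> code_prob d \<theta> n / fact n" for \<epsilon> :: real and d n :: nat
  have "\<forall>\<^sub>F d in sequentially. \<exists>n. good (1 / real (Suc k)) d n" for k
    unfolding good_def by (rule eventually_code_size[OF assms]) simp
  hence "\<exists>\<kappa>. filterlim \<kappa> at_top sequentially \<and>
      (\<forall>\<^sub>F d in sequentially. \<exists>n. good (1 / real (Suc (\<kappa> d))) d n)"
    by (rule diagonal_sequence)
  then obtain \<kappa> where \<kappa>: "filterlim \<kappa> at_top sequentially"
    and ev: "\<forall>\<^sub>F d in sequentially. \<exists>n. good (1 / real (Suc (\<kappa> d))) d n"
    by (elim exE conjE)
  define n where "n d = (if \<exists>n. good (1 / real (Suc (\<kappa> d))) d n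
     then SOME n. good (1 / real (Suc (\<kappa> d))) d n else 1)" for d
  define \<epsilon> where "\<epsilon> d = - (1 / real (Suc (\<kappa> d)))" for d
  have n: "good (1 / real (Suc (\<kappa> d))) d (n d)" if "\<exists>n. good (1 / real (Suc (\<kappa> d))) d n" for d
    using that someI_ex[OF that] by (simp add: n_def)
  have n0: "n d > 0" for d
    using n[of d] by (cases "\<exists>n. good (1 / real (Suc (\<kappa> d))) d n") (auto simp: good_def n_def)
  have lim: "(\<lambda>k. - (1 / real (Suc k))) \<longlonglongrightarrow> 0" by real_asymp
  have "\<epsilon> \<longlonglongrightarrow> 0" unfolding \<epsilon>_def by (rule filterlim_compose[OF lim \<kappa>])
  moreover have "\<forall>\<^sub>F d in sequentially.
      real (n d) \<ge> (1 + \<epsilon> d) * (cap_c \<theta> * real d / cap_area d \<theta>) \<and>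
      code_prob d \<theta> (n d) > 0 \<and>
      1 / real (n d) * ln (code_prob d \<theta> (n d) / fact (n d)) \<ge> ln (cap_area d (cap_q \<theta>)) + 0"
    using ev
  proof eventually_elim
    case (elim d)
    note g = n[OF elim, unfolded good_def]
    have "ln (cap_area d (cap_q \<theta>) ^ n d) \<le> ln (code_prob d \<theta> (n d) / fact (n d))"
      using g by (intro ln_mono) auto
    hence "n d * ln (cap_area d (cap_q \<theta>)) \<le> ln (code_prob d \<theta> (n d) / fact (n d))"
      using g by (simp add: ln_realpow)
    hence "ln (cap_area d (cap_q \<theta>)) \<le> 1 / real (n d) * ln (code_prob d \<theta> (n d) / fact (n d))"
      using n0[of d] by (simp add: field_simps)
    thus ?case using g by (simp add: \<epsilon>_def)
  qed
  ultimately show ?thesis using n0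
    by (intro exI[of _ n] exI[of _ \<epsilon>] exI[of _ "\<lambda>_. 0"] conjI allI tendsto_const)
qed

end
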